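(* Let $\Omega\subseteq\mathbb{R}^d$ be a bounded open set, $n,m\ge1$, $p\in(1,+\infty)$, and let $f:\Omega\times\square^n\times\mathbb{M}^{m\times d}\to[0,+\infty)$, $f=f(x,y^1,\dots,y^n,z)$, satisfy: (1) $f(x,y^1,\dots,y^n,\cdot)$ is convex for all $x\in\Omega$ and $y^1,\dots,y^n\in\square$; (2) there are $c_1,c_2>0$ with $c_1|z|^p\le f(x,y^1,\dots,y^n,z)\le c_2(1+|z|^p)$ for all $(x,y^1,\dots,y^n,z)\in\Omega\times\square^n\times\mathbb{M}^{m\times d}$; (3) for every $\delta>0$ there exist a compact set $X\subseteq\Omega$ with $|\Omega\setminus X|\le\delta$ and a compact set $Y\subseteq\square$ with $|\square\setminus Y|\le\delta$ such that $f|_{X\times Y^n\times\mathbb{M}^{m\times d}}$ is continuous. Define $$f_{hom}(x,z):=\inf_{\phi\in\Phi}\int_{\square^n}f\Bigl(x,y^1,\dots,y^n,z+\sum_{k=1}^n\nabla_{y^k}\phi_k(y^1,\dots,y^k)\Bigr)\,dy^1\cdots dy^n,\qquad \Phi:=\prod_{k=1}^nL^p\bigl(\square^{k-1},W^{1,p}_{per}(\square,\mathbb{R}^m)\bigr),$$ and define iteratively $$f^{[n]}_{hom}(x,y^1,\dots,y^{n-1},z):=\inf_{\phi\in W^{1,p}_{per}(\square,\mathbb{R}^m)}\int_\square f\bigl(x,y^1,\dots,y^n,z+\nabla\phi(y^n)\bigr)\,dy^n,$$ and, for $k=n-1,n-2,\dots,1$, $$f^{[k]}_{hom}(x,y^1,\dots,y^{k-1},z):=\inf_{\phi\in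 W^{1,p}_{per}(\square,\mathbb{R}^m)}\int_\square f^{[k+1]}_{hom}\bigl(x,y^1,\dots,y^k,z+\nabla\phi(y^k)\bigr)\,dy^k.$$ Then $f_{hom}(x,z)=f^{[1]}_{hom}(x,z)$ for all $(x,z)\in\Omega\times\mathbb{M}^{m\times d}$.
   Context: $\square=[0,1)^d$ is the unit cell; $\mathbb{M}^{m\times d}$ is the space of real $m\times d$ matrices; $|A|$ is the Lebesgue measure of a set $A$. $W^{1,p}_{per}(\square,\mathbb{R}^m)$ is the space of $\square$-periodic functions in $W^{1,p}_{loc}(\mathbb{R}^d,\mathbb{R}^m)$. The $k$-th component $\phi_k(y^1,\dots,y^k)$ of $\phi=(\phi_1,\dots,\phi_n)\in\Phi$ is viewed as a map of $(y^1,\dots,y^{k-1})\in\square^{k-1}$ with values in periodic functions of $y^k$ (for $k=1$ it is just an element of $W^{1,p}_{per}(\square,\mathbb{R}^m)$), and $\nabla_{y^k}$ is the gradient with respect to $y^k$.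
   Formalization: The equality is stated for those x in Ω for which y ↦ f(x,y,z) is Lebesgue measurable on □^n for every z; condition (3) gives this only for almost every x, and without it the integral defining f_hom(x,z) is undefined. *)

theory Defs
  imports "HOL-Analysis.Analysis"
begin

text \<open>
  Points of R^d have type \<open>real^'d\<close>; m x d matrices have type \<open>real^'d^'m\<close>, with the Frobenius
  norm; the matrix \<open>Du y\<close> has the entry \<open>Du y $ i $ j\<close> = d u_i / d y_j.
  A tuple (y^1, ..., y^k) is an extensional function on \<open>{1..k}\<close>, so that the tuple
  extending \<open>y\<close> by \<open>y^k = t\<close> is \<open>y(k := t)\<close>, and the empty tuple is \<open>\<lambda>_. undefined\<close>.
\<close>

definition unit_cell :: "(real^'d) set" where
  "unit_cell = {y. \<forall>i. 0 \<le> y $ i \<and> y $ i < 1}"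

definition cells :: "nat \<Rightarrow> (nat \<Rightarrow> real^'d) set" where
  "cells k = (\<Pi>\<^sub>E i\<in>{1..k}. unit_cell)"

text \<open>The Lebesgue measure on the k-fold product of the unit cell (with the one-point measure
  of mass 1 for \<open>k = 0\<close>). A plain \<open>PiM\<close> is not complete, hence the completion.\<close>

definition cells_measure :: "nat \<Rightarrow> (nat \<Rightarrow> real^'d) measure" where
  "cells_measure k = completion (\<Pi>\<^sub>M i\<in>{1..k}. lebesgue_on unit_cell)"


subsection \<open>Weak gradients and periodic Sobolev functions\<close>

definition partial_deriv :: "'d \<Rightarrow> (real^'d \<Rightarrow> real) \<Rightarrow> real^'d \<Rightarrow> real" where
  "partial_deriv j \<psi> y = frechet_derivative \<psi> (at y) (axis j 1)"

primrec Ck :: "nat \<Rightarrow> (real^'d \<Rightarrow> real) \<Rightarrow> bool" where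
  "Ck 0 \<psi> \<longleftrightarrow> continuous_on UNIV \<psi>"
| "Ck (Suc k) \<psi> \<longleftrightarrow> (\<forall>y. \<psi> differentiable (at y)) \<and> (\<forall>j. Ck k (partial_deriv j \<psi>))"

definition test_functions :: "(real^'d \<Rightarrow> real) set" where
  "test_functions = {\<psi>. (\<forall>k. Ck k \<psi>) \<and> compact (closure {y. \<psi> y \<noteq> 0})}"

definition locally_integrable :: "(real^'d \<Rightarrow> 'b::euclidean_space) \<Rightarrow> bool" where
  "locally_integrable u \<longleftrightarrow> u \<in> borel_measurable lebesgue \<and>
     (\<forall>K. compact K \<longrightarrow> set_integrable lebesgue K u)"

definition Lp_loc :: "real \<Rightarrow> (real^'d \<Rightarrow> 'b::euclidean_space) set" where
  "Lp_loc p = {u. u \<in> borel_measurable lebesgue \<and>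
     (\<forall>K. compact K \<longrightarrow> (\<integral>\<^sup>+ y\<in>K. ennreal (norm (u y) powr p) \<partial>lebesgue) < \<infinity>)}"

definition has_weak_gradient :: "(real^'d \<Rightarrow> real^'m) \<Rightarrow> (real^'d \<Rightarrow> real^'d^'m) \<Rightarrow> bool" where
  "has_weak_gradient u Du \<longleftrightarrow> locally_integrable u \<and> locally_integrable Du \<and>
     (\<forall>\<psi>\<in>test_functions. \<forall>i j.
        (\<integral>y. u y $ i * partial_deriv j \<psi> y \<partial>lebesgue) =
        - (\<integral>y. Du y $ i $ j * \<psi> y \<partial>lebesgue))"

definition weakly_differentiable :: "(real^'d \<Rightarrow> real^'m) \<Rightarrow> bool" where
  "weakly_differentiable u \<longleftrightarrow> (\<exists>Du. has_weak_gradient u Du)"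

text \<open>The weak gradient is unique up to null sets; \<open>weak_gradient\<close> selects a version.\<close>

definition weak_gradient :: "(real^'d \<Rightarrow> real^'m) \<Rightarrow> real^'d \<Rightarrow> real^'d^'m" where
  "weak_gradient u = (SOME Du. has_weak_gradient u Du)"

definition W1p_per :: "real \<Rightarrow> (real^'d \<Rightarrow> real^'m) set" where
  "W1p_per p = {u. (\<forall>i. AE y in lebesgue. u (y + axis i 1) = u y) \<and>
     u \<in> Lp_loc p \<and> weakly_differentiable u \<and> weak_gradient u \<in> Lp_loc p}"


subsection \<open>The Bochner space of p-integrable maps with values in periodic Sobolev functions\<close>

text \<open>The p-th powers of the norm of \<open>u\<close> and of the distance of \<open>u\<close> and \<open>v\<close>.\<close>

definition W1p_norm_pow :: "real \<Rightarrow> (real^'d \<Rightarrow> real^'m) \<Rightarrow> ennreal" where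
  "W1p_norm_pow p u =
     (\<integral>\<^sup>+ t. ennreal (norm (u t) powr p + norm (weak_gradient u t) powr p)
        \<partial>lebesgue_on unit_cell)"

definition W1p_dist_pow :: "real \<Rightarrow> (real^'d \<Rightarrow> real^'m) \<Rightarrow> (real^'d \<Rightarrow> real^'m) \<Rightarrow> ennreal" where
  "W1p_dist_pow p u v =
     (\<integral>\<^sup>+ t. ennreal (norm (u t - v t) powr p
              + norm (weak_gradient u t - weak_gradient v t) powr p) \<partial>lebesgue_on unit_cell)"

text \<open>Strong measurability: an almost everywhere limit, in the Sobolev norm, of simple maps.\<close>

definition Bochner_Lp_W1p :: "real \<Rightarrow> nat \<Rightarrow> ((nat \<Rightarrow> real^'d) \<Rightarrow> real^'d \<Rightarrow> real^'m) set" where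
  "Bochner_Lp_W1p p k = {\<phi>.
     (\<forall>y\<in>cells k. \<phi> y \<in> W1p_per p) \<and>
     (\<exists>s. (\<forall>j. simple_function (cells_measure k) (s j) \<and> (\<forall>y\<in>cells k. s j y \<in> W1p_per p)) \<and>
          (AE y in cells_measure k. (\<lambda>j. W1p_dist_pow p (s j y) (\<phi> y)) \<longlonglongrightarrow> 0)) \<and>
     (\<integral>\<^sup>+ y. W1p_norm_pow p (\<phi> y) \<partial>cells_measure k) < \<infinity>}"

definition Phi :: "real \<Rightarrow> nat \<Rightarrow> (nat \<Rightarrow> (nat \<Rightarrow> real^'d) \<Rightarrow> real^'d \<Rightarrow> real^'m) set" where
  "Phi p n = (\<Pi>\<^sub>E k\<in>{1..n}. Bochner_Lp_W1p p (k - 1))"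

text \<open>The gradient in y^k of \<open>\<phi>\<close>, seen as a function of (y^1, ..., y^k), is determined up to null
  sets as a jointly measurable function whose sections are the weak gradients. (Selecting a
  version of the weak gradient separately for each (y^1, ..., y^{k-1}) would not give a jointly
  measurable function.)\<close>

definition is_gradient_in ::
  "nat \<Rightarrow> ((nat \<Rightarrow> real^'d) \<Rightarrow> real^'d \<Rightarrow> real^'m) \<Rightarrow> ((nat \<Rightarrow> real^'d) \<Rightarrow> real^'d^'m) \<Rightarrow> bool" where
  "is_gradient_in k \<phi> D \<longleftrightarrow> D \<in> borel_measurable (cells_measure k) \<and>
     (AE y in cells_measure (k - 1). AE t in lebesgue_on unit_cell.
        D (y(k := t)) = weak_gradient (\<phi> y) t)"


subsection \<open>The homogenized integrands\<close>

definition f_hom ::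
  "real \<Rightarrow> nat \<Rightarrow> (real^'d \<Rightarrow> (nat \<Rightarrow> real^'d) \<Rightarrow> real^'d^'m \<Rightarrow> real)
     \<Rightarrow> real^'d \<Rightarrow> real^'d^'m \<Rightarrow> ennreal" where
  "f_hom p n f x z = Inf
     {(\<integral>\<^sup>+ y. ennreal (f x y (z + (\<Sum>k=1..n. D k (restrict y {1..k})))) \<partial>cells_measure n)
      | \<phi> D. \<phi> \<in> Phi p n \<and> (\<forall>k\<in>{1..n}. is_gradient_in k (\<phi> k) (D k))}"

text \<open>\<open>f_hom_iter p n f k\<close> is the k-th iterated integrand; the recursion starts from \<open>f\<close> itself
  at \<open>k = n + 1\<close>.\<close>

function f_hom_iter ::
  "real \<Rightarrow> nat \<Rightarrow> (real^'d \<Rightarrow> (nat \<Rightarrow> real^'d) \<Rightarrow> real^'d^'m \<Rightarrow> real)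
     \<Rightarrow> nat \<Rightarrow> real^'d \<Rightarrow> (nat \<Rightarrow> real^'d) \<Rightarrow> real^'d^'m \<Rightarrow> ennreal" where
  "f_hom_iter p n f k x y z =
     (if k > n then ennreal (f x y z)
      else INF \<phi>\<in>W1p_per p.
        \<integral>\<^sup>+ t. f_hom_iter p n f (Suc k) x (y(k := t)) (z + weak_gradient \<phi> t)
          \<partial>lebesgue_on unit_cell)"
  by pat_completeness auto
termination by (relation "Wellfounded.measure (\<lambda>(p, n, f, k, x, y, z). Suc n - k)") auto

declare f_hom_iter.simps [simp del]


subsection \<open>Admissibility and measurability of the sections\<close>

definition admissible ::
  "(real^'d) set \<Rightarrow> nat \<Rightarrow> (real^'d \<Rightarrow> (nat \<Rightarrow> real^'d) \<Rightarrow> real^'d^'m \<Rightarrow> real) \<Rightarrow> bool" where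
  "admissible \<Omega> n f \<longleftrightarrow> (\<forall>\<delta>>0. \<exists>X Y.
     compact X \<and> X \<subseteq> \<Omega> \<and> emeasure lebesgue (\<Omega> - X) \<le> ennreal \<delta> \<and>
     compact Y \<and> Y \<subseteq> unit_cell \<and> emeasure lebesgue (unit_cell - Y) \<le> ennreal \<delta> \<and>
     continuous_on (X \<times> (\<Pi>\<^sub>E i\<in>{1..n}. Y) \<times> UNIV) (\<lambda>(x, y, z). f x y z))"

definition measurable_section ::
  "nat \<Rightarrow> (real^'d \<Rightarrow> (nat \<Rightarrow> real^'d) \<Rightarrow> real^'d^'m \<Rightarrow> real) \<Rightarrow> real^'d \<Rightarrow> bool" where
  "measurable_section n f x \<longleftrightarrow> (\<forall>z. (\<lambda>y. f x y z) \<in> borel_measurable (cells_measure n))"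

lemma unit_cell_measurable: "(unit_cell :: (real^'d) set) \<in> sets lebesgue"
  and emeasure_unit_cell: "emeasure lebesgue (unit_cell :: (real^'d) set) = 1"
proof -
  let ?b = "box 0 (\<chi> i. 1) :: (real^'d) set" and ?c = "cbox 0 (\<chi> i. 1) :: (real^'d) set"
  have sub: "?b \<subseteq> unit_cell" "unit_cell \<subseteq> ?c"
    by (auto simp: unit_cell_def mem_box_cart less_imp_le)
  have neg: "negligible (?c - ?b)"
    by (rule negligible_frontier_interval)
  have *: "unit_cell = ?b \<union> (unit_cell - ?b)"
    using sub by auto
  have neg': "negligible (unit_cell - ?b)"
    by (rule negligible_subset[OF neg]) (use sub in auto)
  then have nul: "(unit_cell - ?b) \<in> null_sets lebesgue"
    by (simp add: negligible_iff_null_sets)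
  show "(unit_cell :: (real^'d) set) \<in> sets lebesgue"
    by (subst *, rule sets.Un) (use nul in auto)
  have "emeasure lebesgue (unit_cell :: (real^'d) set) = emeasure lebesgue ?b"
    by (subst *) (rule emeasure_Un_null_set, use nul in auto)
  also have "\<dots> = emeasure lborel ?b" by simp
  also have "\<dots> = 1"
    by (subst emeasure_lborel_box_eq) (auto simp: Basis_vec_def inner_axis intro!: prod.neutral)
  finally show "emeasure lebesgue (unit_cell :: (real^'d) set) = 1" .
qed

lemma null_setsI_tendsto:
  fixes a :: "nat \<Rightarrow> real"
  assumes "A \<in> sets M" and "a \<longlonglongrightarrow> 0" and "\<And>k. k \<ge> K \<Longrightarrow> emeasure M A \<le> ennreal (a k)"
  shows "A \<in> null_sets M"
proof -
  have "(\<lambda>k. ennreal (a k)) \<longlonglongrightarrow> ennreal 0"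
    by (intro tendsto_intros assms)
  then have "emeasure M A \<le> ennreal 0"
    by (rule tendsto_lowerbound) (use assms(3) in \<open>auto simp: eventually_at_top_linorder\<close>)
  with assms(1) show ?thesis by auto
qed

text \<open>For an admissible \<open>f\<close> the integrals over the cells make sense for almost every \<open>x\<close>. For
  the remaining \<open>x\<close> admissibility says nothing about \<open>f x\<close>, which may be non-measurable.\<close>

lemma AE_measurable_section:
  fixes \<Omega> :: "(real^'d) set"
    and f :: "real^'d \<Rightarrow> (nat \<Rightarrow> real^'d) \<Rightarrow> real^'d^'m \<Rightarrow> real"
  assumes adm: "admissible \<Omega> n f" and \<Omega>: "\<Omega> \<in> sets lebesgue"
  shows "AE x in lebesgue_on \<Omega>. measurable_section n f x"
proof -
  let ?L = "lebesgue_on unit_cell :: (real^'d) measure"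
  let ?P = "\<Pi>\<^sub>M i\<in>{1..n}. ?L"
  define \<delta> where "\<delta> k = 1 / real (Suc k)" for k
  have \<delta>0: "\<delta> \<longlonglongrightarrow> 0" unfolding \<delta>_def by (rule LIMSEQ_Suc[OF lim_1_over_n])
  have "\<exists>X Y. compact X \<and> X \<subseteq> \<Omega> \<and> emeasure lebesgue (\<Omega> - X) \<le> ennreal (\<delta> k) \<and>
     compact Y \<and> Y \<subseteq> unit_cell \<and> emeasure lebesgue (unit_cell - Y) \<le> ennreal (\<delta> k) \<and>
     continuous_on (X \<times> (\<Pi>\<^sub>E i\<in>{1..n}. Y) \<times> UNIV) (\<lambda>(x, y, z). f x y z)" for k
    using adm unfolding admissible_def by (auto simp: \<delta>_def)
  then obtain X Y where X: "\<And>k. compact (X k)" "\<And>k. X k \<subseteq> \<Omega>"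
      "\<And>k. emeasure lebesgue (\<Omega> - X k) \<le> ennreal (\<delta> k)"
    and Y: "\<And>k. compact (Y k)" "\<And>k. Y k \<subseteq> unit_cell"
      "\<And>k. emeasure lebesgue (unit_cell - Y k) \<le> ennreal (\<delta> k)"
    and cont: "\<And>k. continuous_on (X k \<times> (\<Pi>\<^sub>E i\<in>{1..n}. Y k) \<times> UNIV) (\<lambda>(x, y, z). f x y z)"
    by metis
  have mX [measurable]: "X k \<in> sets lebesgue" and mY: "Y k \<in> sets lebesgue" for k
    using X(1)[of k] Y(1)[of k]
    by (metis borel_compact sets_completionI_sets sets_lborel)+
  define bad where "bad = (\<Union>K. \<Omega> - (\<Union>k\<in>{K..}. X k))"
  have "\<Omega> - (\<Union>k\<in>{K..}. X k) \<in> null_sets lebesgue" for K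
  proof (rule null_setsI_tendsto[OF _ \<delta>0, where K = K])
    show "\<Omega> - (\<Union>k\<in>{K..}. X k) \<in> sets lebesgue" using \<Omega> by measurable
    fix k assume "K \<le> k"
    then have "emeasure lebesgue (\<Omega> - (\<Union>k\<in>{K..}. X k)) \<le> emeasure lebesgue (\<Omega> - X k)"
      using \<Omega> by (intro emeasure_mono) auto
    then show "emeasure lebesgue (\<Omega> - (\<Union>k\<in>{K..}. X k)) \<le> ennreal (\<delta> k)"
      using X(3)[of k] by (rule order_trans)
  qed
  then have bad: "bad \<in> null_sets lebesgue"
    unfolding bad_def by (rule null_sets_UN)
  have "measurable_section n f x" if x: "x \<in> \<Omega> - bad" for x
    unfolding measurable_section_def
  proof
    fix z
    define S where "S = {k. x \<in> X k}"
    have S: "\<exists>k\<ge>K. k \<in> S" for K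
      using x by (auto simp: bad_def S_def)
    interpret L: finite_measure ?L
      by (rule finite_measureI)
        (simp add: unit_cell_measurable emeasure_restrict_space space_restrict_space emeasure_unit_cell)
    interpret P: product_sigma_finite "\<lambda>_::nat. ?L" by standard
    define A where "A k = (\<Pi>\<^sub>E i\<in>{1..n}. Y k)" for k
    define B where "B = space ?P - (\<Union>k\<in>S. A k)"
    have mY': "Y k \<in> sets ?L" "unit_cell - Y k \<in> sets ?L" "unit_cell \<in> sets ?L" for k
      using mY[of k] Y(2)[of k] unit_cell_measurable
        sets_restrict_space_iff[of unit_cell "lebesgue :: (real^'d) measure"]
      by auto
    have eL1: "emeasure ?L unit_cell = 1"
      using unit_cell_measurable emeasure_unit_cell by (subst emeasure_restrict_space) auto
    have eL2: "emeasure ?L (unit_cell - Y k) \<le> ennreal (\<delta> k)" for k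
      using unit_cell_measurable Y(3)[of k] by (subst emeasure_restrict_space) auto
    have mA: "A k \<in> sets ?P" for k
      unfolding A_def by (intro sets_PiM_I_finite) (use mY' in auto)
    have mB: "B \<in> sets ?P" unfolding B_def using mA by (intro sets.Diff sets.countable_UN') auto
    have nB: "B \<in> null_sets ?P"
    proof (rule ccontr)
      have *: "emeasure ?P (space ?P - A k) \<le> ennreal (real n * \<delta> k)" for k
      proof -
        let ?C = "\<lambda>i. \<Pi>\<^sub>E j\<in>{1..n}. if j = i then unit_cell - Y k else unit_cell"
        have mC: "?C i \<in> sets ?P" for i by (intro sets_PiM_I_finite) (use mY' in auto)
        have eC: "emeasure ?P (?C i) \<le> ennreal (\<delta> k)" if "i \<in> {1..n}" for i
        proof -
          have "emeasure ?P (?C i) = (\<Prod>j\<in>{1..n}. emeasure ?L (if j = i then unit_cell - Y k else unit_cell))"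
            by (rule P.emeasure_PiM) (use mY' in auto)
          also have "\<dots> = (\<Prod>j\<in>{1..n}. if j = i then emeasure ?L (unit_cell - Y k) else 1)"
            by (rule prod.cong) (auto simp: eL1)
          also have "\<dots> = emeasure ?L (unit_cell - Y k)" using that by simp
          finally show ?thesis using eL2[of k] by simp
        qed
        have "emeasure ?P (space ?P - A k) \<le> emeasure ?P (\<Union>i\<in>{1..n}. ?C i)"
        proof (rule emeasure_mono)
          show "space ?P - A k \<subseteq> (\<Union>i\<in>{1..n}. ?C i)"
            by (fastforce simp: space_PiM space_restrict_space A_def PiE_iff split: if_splits)
          show "(\<Union>i\<in>{1..n}. ?C i) \<in> sets ?P" by (intro sets.finite_UN mC) auto
        qed
        also have "\<dots> \<le> (\<Sum>i\<in>{1..n}. emeasure ?P (?C i))"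
          by (rule emeasure_subadditive_finite) (use mC in auto)
        also have "\<dots> \<le> (\<Sum>i\<in>{1..n}. ennreal (\<delta> k))" by (intro sum_mono eC)
        also have "\<dots> = ennreal (real n * \<delta> k)"
          using ennreal_mult[of "real n" "\<delta> k"]
          by (simp add: ennreal_of_nat_eq_real_of_nat \<delta>_def)
        finally show ?thesis .
      qed
      have dec: "\<delta> k \<le> \<delta> K" if "K \<le> k" for k K
        using that unfolding \<delta>_def by (intro divide_left_mono) auto
      have "B \<in> null_sets ?P"
      proof (rule null_setsI_tendsto[where K = 0 and a = "\<lambda>k. real n * \<delta> k"])
        show "(\<lambda>k. real n * \<delta> k) \<longlonglongrightarrow> 0"
          using tendsto_mult_right_zero[OF \<delta>0] by simp
        fix K
        obtain k where k: "K \<le> k" "k \<in> S" using S by blast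
        have "emeasure ?P B \<le> emeasure ?P (space ?P - A k)"
          using mA k by (intro emeasure_mono) (auto simp: B_def)
        also have "\<dots> \<le> ennreal (real n * \<delta> K)"
          using *[of k] dec[OF k(1)] by (meson ennreal_leI mult_left_mono of_nat_0_le_iff order_trans)
        finally show "emeasure ?P B \<le> ennreal (real n * \<delta> K)" .
      qed (fact mB)
      moreover assume "B \<notin> null_sets ?P"
      ultimately show False by simp
    qed
    have id: "(\<lambda>y. y) \<in> borel_measurable ?P"
    proof (rule measurable_coordinatewise_then_product)
      fix i
      show "(\<lambda>y. y i) \<in> borel_measurable ?P"
      proof (cases "i \<in> {1..n}")
        case True
        have "(\<lambda>y. y i) \<in> measurable ?P ?L" by (rule measurable_component_singleton) fact
        moreover have "(\<lambda>y. y) \<in> borel_measurable ?L"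
          by (intro measurable_restrict_space1 measurable_completion) auto
        ultimately show ?thesis by (rule measurable_compose)
      next
        case False
        have "(\<lambda>y. y i) \<in> borel_measurable ?P \<longleftrightarrow> (\<lambda>_. undefined :: real^'d) \<in> borel_measurable ?P"
          by (rule measurable_cong) (use False in \<open>auto simp: space_PiM PiE_def extensional_def\<close>)
        then show ?thesis by simp
      qed
    qed
    have fA: "(\<lambda>y. f x y z) \<in> borel_measurable (restrict_space ?P (A k))" if "k \<in> S" for k
    proof -
      have "continuous_on (A k) ((\<lambda>(x, y, z). f x y z) \<circ> (\<lambda>y. (x, y, z)))"
        by (rule continuous_on_compose)
          (auto intro!: continuous_intros continuous_on_subset[OF cont[of k]] simp: A_def
            that[unfolded S_def, simplified])
      then have "(\<lambda>y. f x y z) \<in> borel_measurable (restrict_space borel (A k))"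
        by (intro borel_measurable_continuous_on_restrict) (simp add: o_def)
      moreover have "(\<lambda>y. y) \<in> measurable (restrict_space ?P (A k)) (restrict_space borel (A k))"
        by (intro measurable_restrict_space2 measurable_restrict_space1 id) (auto simp: space_restrict_space)
      ultimately show ?thesis by (rule measurable_compose[rotated])
    qed
    let ?A = "\<Union>k\<in>S. A k"
    have f1: "(\<lambda>y. f x y z) \<in> borel_measurable (restrict_space ?P ?A)"
    proof (rule measurable_piecewise_restrict[where C = "A ` S"])
      fix \<Theta> assume "\<Theta> \<in> A ` S"
      then obtain k where k: "k \<in> S" "\<Theta> = A k" by auto
      have A: "?A \<in> sets ?P" using mA by (intro sets.countable_UN') auto
      have *: "?A \<inter> A k = A k" using k by auto
      show "\<Theta> \<inter> space (restrict_space ?P ?A) \<in> sets (restrict_space ?P ?A)"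
        using mA A by (auto simp: k sets_restrict_space_iff space_restrict_space)
      show "(\<lambda>y. f x y z) \<in> borel_measurable (restrict_space (restrict_space ?P ?A) \<Theta>)"
        using fA[OF k(1)]
        by (simp add: k(2) sets_restrict_restrict_space restrict_restrict_space * A mA
            cong: measurable_cong_sets)
    qed (auto simp: space_restrict_space)
    have A: "?A \<in> sets ?P" using mA by (intro sets.countable_UN') auto
    let ?Q = "cells_measure n :: (nat \<Rightarrow> real^'d) measure"
    have AQ: "?A \<in> sets ?Q" and spQ: "space ?Q = space ?P"
      using A by (auto simp: cells_measure_def)
    have f2: "(\<lambda>y. f x y z) \<in> borel_measurable (restrict_space ?Q ?A)"
      using f1 A AQ spQ unfolding cells_measure_def
      by (subst borel_measurable_restrict_space_iff; simp)
        (subst (asm) borel_measurable_restrict_space_iff; simp add: measurable_completion)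
    have f3: "(\<lambda>y. f x y z) \<in> borel_measurable (restrict_space ?Q B)"
    proof (rule measurableI)
      fix T :: "real set"
      have "(\<lambda>y. f x y z) -` T \<inter> B \<in> sets ?Q"
        unfolding cells_measure_def by (rule null_sets_completion_subset[of _ B, THEN null_setsD2])
          (use nB null_sets_completionI in auto)
      moreover have "B \<in> sets ?Q" "B \<subseteq> space ?Q" using mB spQ by (auto simp: cells_measure_def B_def)
      ultimately show "(\<lambda>y. f x y z) -` T \<inter> space (restrict_space ?Q B) \<in> sets (restrict_space ?Q B)"
        by (auto simp: sets_restrict_space_iff space_restrict_space Int_absorb2)
    qed auto
    show "(\<lambda>y. f x y z) \<in> borel_measurable ?Q"
      by (rule measurable_piecewise_restrict[of "{?A, B}"])
        (use f2 f3 A mB spQ in \<open>auto simp: cells_measure_def B_def\<close>)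
  qed
  then show ?thesis
    using bad \<Omega> by (subst AE_restrict_space_iff) (auto intro!: AE_I'[of bad])
qed

end

(*
  Write the infimum over one corrector as an operator T taking an integrand h(y^1,...,y^{k+1}, z) to
  (T h)(y^1,...,y^k, z). The infimum over all tuples of correctors is at least the iterated one by
  Fubini's theorem. Conversely, almost optimal correctors have to be chosen measurably in
  (y^1,...,y^k). By the separability of L^p the infimum in T h runs over a fixed sequence of
  correctors, so choosing the best of its first J members gives a simple map of (y^1,...,y^k), and
  the energies decrease to that of T h as J tends to infinity.

  Continuity of T h in z, on which all measurability rests, is carried along as the estimate
  h(y, z + v) <= (1 + eps) h(y, z) + eps + K_eps |v|^p, which T preserves. For f it follows from
  z + v = (1 - l) z + l (z + v / l), convexity and the growth conditions.
*)

theory Submission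
  imports Defs
begin

section \<open>Fubini's theorem on the completed products of the cell\<close>

text \<open>The two sides see gradients differently. An iterated integrand uses one weak gradient at
  a time, for a fixed tuple of earlier variables; \<open>f_hom\<close> uses jointly measurable maps
  \<open>D k\<close> on a completed product, tied to the weak gradients only for almost every
  section. Hence Fubini's theorem has to hold for completions, where sections may be bad on null
  sets.

  The class of integrands carried through the iteration must survive an infimum over uncountably
  many correctors. The estimate does: shifting z by v affects every competitor in the same way, with
  constants that do not depend on the competitor. It compares two values by a factor, so it controls
  differences only where the integrand is finite; the bound at z = 0 supplies this.

  A decreasing sequence of energies may be integrated to its limit only if some member has a finite
  integral. The construction of correctors therefore also records that z plus the gradients chosen
  so far lies in L^p.\<close>

declare One_nat_def [simp del]

abbreviation cell_lebesgue :: "(real^'d) measure" where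
  "cell_lebesgue \<equiv> lebesgue_on unit_cell"

abbreviation cells_PiM :: "nat \<Rightarrow> (nat \<Rightarrow> real^'d) measure" where
  "cells_PiM k \<equiv> \<Pi>\<^sub>M i\<in>{1..k}. cell_lebesgue"

lemma space_cell_lebesgue [simp]: "space cell_lebesgue = unit_cell"
  by (simp add: space_restrict_space)

lemma emeasure_cell_lebesgue [simp]: "emeasure cell_lebesgue (unit_cell :: (real^'d) set) = 1"
  using unit_cell_measurable emeasure_unit_cell by (subst emeasure_restrict_space) auto

lemma finite_measure_cell_lebesgue: "finite_measure (cell_lebesgue :: (real^'d) measure)"
  by (rule finite_measureI) simp

lemma product_sigma_finite_cell_lebesgue:
  "product_sigma_finite (\<lambda>_::nat. cell_lebesgue :: (real^'d) measure)"
proof -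
  interpret finite_measure "cell_lebesgue :: (real^'d) measure"
    by (rule finite_measure_cell_lebesgue)
  show ?thesis by standard
qed

lemma measurable_cell_lebesgue:
  "u \<in> borel_measurable lebesgue \<Longrightarrow> u \<in> borel_measurable cell_lebesgue"
  by (rule measurable_restrict_space1)

lemma space_cells_PiM [simp]: "space (cells_PiM k) = cells k"
  by (simp add: cells_def space_PiM)

lemma space_cells_measure [simp]: "space (cells_measure k) = cells k"
  by (simp add: cells_measure_def cells_def space_PiM)

lemma nn_integral_cells_measure: "integral\<^sup>N (cells_measure k) g = integral\<^sup>N (cells_PiM k) g"
  unfolding cells_measure_def by (rule nn_integral_completion)

lemma AE_cells_measure: "(AE y in cells_measure k. P y) \<longleftrightarrow> (AE y in cells_PiM k. P y)"
  unfolding cells_measure_def by (rule AE_completion_iff)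

lemma emeasure_cells_measure [simp]:
  "emeasure (cells_measure k) (cells k :: (nat \<Rightarrow> real^'d) set) = 1"
proof -
  interpret product_sigma_finite "\<lambda>_::nat. cell_lebesgue :: (real^'d) measure"
    by (rule product_sigma_finite_cell_lebesgue)
  have "emeasure (cells_PiM k) (cells k :: (nat \<Rightarrow> real^'d) set) = 1"
    unfolding cells_def
    using sets.top[of "cell_lebesgue :: (real^'d) measure"] by (subst emeasure_PiM) auto
  moreover have "cells k \<in> sets (cells_PiM k :: (nat \<Rightarrow> real^'d) measure)"
    using sets.top[of "cells_PiM k :: (nat \<Rightarrow> real^'d) measure"] by simp
  ultimately show ?thesis
    by (simp add: cells_measure_def)
qed

lemma atLeast1_Suc: "{1..Suc k} = insert (Suc k) {1..k}"
  by auto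

lemma cells_fun_upd: "y \<in> cells k \<Longrightarrow> t \<in> unit_cell \<Longrightarrow> y(Suc k := t) \<in> cells (Suc k)"
  by (auto simp: cells_def PiE_iff extensional_def)

lemma restrict_cells_fun_upd: "y \<in> cells k \<Longrightarrow> restrict (y(Suc k := t)) {1..k} = y"
  by (auto simp: cells_def PiE_iff extensional_def restrict_def fun_eq_iff)

lemma restrict_cells: "y \<in> cells k \<Longrightarrow> restrict y {1..k} = y"
  by (auto simp: cells_def PiE_iff intro: extensional_restrict)

lemma restrict_in_cells: "y \<in> cells n \<Longrightarrow> k \<le> n \<Longrightarrow> restrict y {1..k} \<in> cells k"
  by (auto simp: cells_def PiE_iff)

lemma measurable_fun_upd_cells_PiM:
  "(\<lambda>(y, t). y(Suc k := t)) \<in> cells_PiM k \<Otimes>\<^sub>M cell_lebesgue \<rightarrow>\<^sub>M cells_PiM (Suc k)"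
  unfolding atLeast1_Suc by (rule measurable_add_dim)

lemma nn_integral_cells_PiM_Suc:
  fixes g :: "(nat \<Rightarrow> real^'d) \<Rightarrow> ennreal"
  assumes "g \<in> borel_measurable (cells_PiM (Suc k))"
  shows "integral\<^sup>N (cells_PiM (Suc k)) g =
      (\<integral>\<^sup>+ y. (\<integral>\<^sup>+ t. g (y(Suc k := t)) \<partial>cell_lebesgue) \<partial>cells_PiM k)"
    and "(\<lambda>y. \<integral>\<^sup>+ t. g (y(Suc k := t)) \<partial>cell_lebesgue) \<in> borel_measurable (cells_PiM k)"
proof -
  interpret product_sigma_finite "\<lambda>_::nat. cell_lebesgue :: (real^'d) measure"
    by (rule product_sigma_finite_cell_lebesgue)
  show "integral\<^sup>N (cells_PiM (Suc k)) g =
      (\<integral>\<^sup>+ y. (\<integral>\<^sup>+ t. g (y(Suc k := t)) \<partial>cell_lebesgue) \<partial>cells_PiM k)"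
    using assms unfolding atLeast1_Suc by (intro product_nn_integral_insert) auto
  interpret finite_measure "cell_lebesgue :: (real^'d) measure"
    by (rule finite_measure_cell_lebesgue)
  have "(\<lambda>(y, t). g (y(Suc k := t))) \<in> borel_measurable (cells_PiM k \<Otimes>\<^sub>M cell_lebesgue)"
    using measurable_comp[OF measurable_fun_upd_cells_PiM assms] by (simp add: o_def case_prod_unfold)
  then show "(\<lambda>y. \<integral>\<^sup>+ t. g (y(Suc k := t)) \<partial>cell_lebesgue) \<in> borel_measurable (cells_PiM k)"
    by (rule borel_measurable_nn_integral)
qed

text \<open>The exceptional set lies in a null set of the uncompleted product, where Tonelli's
  theorem applies to the indicator. Its double integral vanishes, so almost every section is
  null.\<close>

lemma AE_cells_measure_Suc:
  fixes P :: "(nat \<Rightarrow> real^'d) \<Rightarrow> bool"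
  assumes "AE y in cells_measure (Suc k). P y"
  shows "AE y in cells_measure k. AE t in cell_lebesgue. P (y(Suc k := t))"
proof -
  have "AE y in cells_PiM (Suc k). P y"
    using assms by (simp add: AE_cells_measure)
  then obtain N where N: "N \<in> null_sets (cells_PiM (Suc k))"
      "{y \<in> space (cells_PiM (Suc k)). \<not> P y} \<subseteq> N"
    by (auto simp: eventually_ae_filter)
  have ind: "indicator N \<in> borel_measurable (cells_PiM (Suc k))"
    using N by (intro borel_measurable_indicator) auto
  have "(\<integral>\<^sup>+ y. (\<integral>\<^sup>+ t. indicator N (y(Suc k := t)) \<partial>cell_lebesgue) \<partial>cells_PiM k) =
      (0 :: ennreal)"
    using nn_integral_indicator[OF null_setsD2[OF N(1)]] null_setsD1[OF N(1)]
    by (simp add: nn_integral_cells_PiM_Suc(1)[OF ind, symmetric])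
  then have "AE y in cells_PiM k. (\<integral>\<^sup>+ t. indicator N (y(Suc k := t)) \<partial>cell_lebesgue) = (0 :: ennreal)"
    unfolding nn_integral_0_iff_AE[OF nn_integral_cells_PiM_Suc(2)[OF ind]] .
  then have "AE y in cells_PiM k. AE t in cell_lebesgue. P (y(Suc k := t))"
    using AE_space
  proof eventually_elim
    fix y :: "nat \<Rightarrow> real^'d"
    assume y: "y \<in> space (cells_PiM k)"
      and 0: "(\<integral>\<^sup>+ t. indicator N (y(Suc k := t)) \<partial>cell_lebesgue) = (0 :: ennreal)"
    have m: "(\<lambda>t. indicator N (y(Suc k := t)) :: ennreal) \<in> borel_measurable cell_lebesgue"
      using measurable_Pair2[OF measurable_comp[OF measurable_fun_upd_cells_PiM ind] y]
      by (simp add: o_def)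
    have "AE t in cell_lebesgue. indicator N (y(Suc k := t)) = (0 :: ennreal)"
      using 0 by (rule iffD1[OF nn_integral_0_iff_AE[OF m]])
    then show "AE t in cell_lebesgue. P (y(Suc k := t))"
      using AE_space
    proof eventually_elim
      fix t :: "real^'d" assume "t \<in> space cell_lebesgue"
        and *: "indicator N (y(Suc k := t)) = (0 :: ennreal)"
      then have "y(Suc k := t) \<in> space (cells_PiM (Suc k))"
        using y cells_fun_upd[of y k t] by auto
      then show "P (y(Suc k := t))"
        using * N(2) by (auto simp: indicator_def split: if_splits)
    qed
  qed
  then show ?thesis by (simp add: AE_cells_measure)
qed

text \<open>The exceptional tuples lie in the cylinder over a null set, and the cylinder is null
  because the added factor has mass 1.\<close>

lemma AE_cells_measure_Suc_restrict:
  fixes P :: "(nat \<Rightarrow> real^'d) \<Rightarrow> bool"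
  assumes "AE y in cells_measure k. P y"
  shows "AE y in cells_measure (Suc k). P (restrict y {1..k})"
proof -
  let ?r = "\<lambda>y::nat \<Rightarrow> real^'d. restrict y {1..k}"
  have r: "?r \<in> cells_PiM (Suc k) \<rightarrow>\<^sub>M cells_PiM k"
    by (rule measurable_restrict_subset) auto
  have "AE y in cells_PiM k. P y"
    using assms by (simp add: AE_cells_measure)
  then obtain N where N: "N \<in> null_sets (cells_PiM k)" "{y \<in> space (cells_PiM k). \<not> P y} \<subseteq> N"
    by (auto simp: eventually_ae_filter)
  let ?N = "?r -` N \<inter> space (cells_PiM (Suc k))"
  have sN: "?N \<in> sets (cells_PiM (Suc k))"
    using N by (intro measurable_sets[OF r]) auto
  have "emeasure (cells_PiM (Suc k)) ?N = integral\<^sup>N (cells_PiM (Suc k)) (indicator ?N)"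
    using sN by (subst nn_integral_indicator) auto
  also have "\<dots> = (\<integral>\<^sup>+ y. (\<integral>\<^sup>+ t. indicator ?N (y(Suc k := t)) \<partial>cell_lebesgue) \<partial>cells_PiM k)"
    using sN by (intro nn_integral_cells_PiM_Suc(1) borel_measurable_indicator)
  also have "\<dots> \<le> (\<integral>\<^sup>+ y. (\<integral>\<^sup>+ t. indicator N y \<partial>(cell_lebesgue :: (real^'d) measure)) \<partial>cells_PiM k)"
    by (intro nn_integral_mono) (auto simp: indicator_def restrict_cells)
  also have "\<dots> = (\<integral>\<^sup>+ y. indicator N y \<partial>cells_PiM k)"
    by simp
  also have "\<dots> = 0"
    using nn_integral_indicator[OF null_setsD2[OF N(1)]] null_setsD1[OF N(1)] by simp
  finally have "?N \<in> null_sets (cells_PiM (Suc k))"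
    using sN by auto
  moreover have "{y \<in> space (cells_PiM (Suc k)). \<not> P (?r y)} \<subseteq> ?N"
    using N(2) restrict_in_cells[of _ "Suc k" k] by auto
  ultimately have "AE y in cells_PiM (Suc k). P (?r y)"
    by (rule AE_I')
  then show ?thesis by (simp add: AE_cells_measure)
qed

lemma complete_measure_cells_measure: "complete_measure (cells_measure k)"
  unfolding cells_measure_def by (rule completion.complete_measure_axioms)

text \<open>Completeness makes a preimage measurable once it differs from a measurable set by a null
  set. The last hypothesis concerns the points where \<open>f\<close> and \<open>g\<close> differ:
  values there could leave \<open>space N\<close>.\<close>

lemma (in complete_measure) measurable_AE_eq:
  assumes g: "g \<in> M \<rightarrow>\<^sub>M N" and eq: "AE x in M. g x = f x" and sp: "f \<in> space M \<rightarrow> space N"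
  shows "f \<in> M \<rightarrow>\<^sub>M N"
proof (rule measurableI)
  fix A assume "A \<in> sets N"
  then have A: "g -` A \<inter> space M \<in> sets M" by (rule measurable_sets[OF g])
  have "AE x in M. x \<in> g -` A \<inter> space M \<longleftrightarrow> x \<in> f -` A \<inter> space M"
    using eq by eventually_elim auto
  then show "f -` A \<inter> space M \<in> sets M"
    by (rule in_sets_AE[OF _ A]) auto
qed (use sp in auto)

text \<open>Tonelli's theorem is applied to a version that is measurable for the plain product.
  Going back changes the inner integral only for a null set of \<open>y\<close>; sections there may
  be non-measurable, which completeness of the outer measure absorbs.\<close>

proposition nn_integral_cells_measure_Suc:
  fixes g :: "(nat \<Rightarrow> real^'d) \<Rightarrow> ennreal"
  assumes "g \<in> borel_measurable (cells_measure (Suc k))"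
  shows "integral\<^sup>N (cells_measure (Suc k)) g =
      (\<integral>\<^sup>+ y. (\<integral>\<^sup>+ t. g (y(Suc k := t)) \<partial>cell_lebesgue) \<partial>cells_measure k)" (is ?eq)
    and "(\<lambda>y. \<integral>\<^sup>+ t. g (y(Suc k := t)) \<partial>cell_lebesgue) \<in> borel_measurable (cells_measure k)" (is ?meas)
proof -
  obtain g' where g': "g' \<in> borel_measurable (cells_PiM (Suc k))"
    and eq: "AE y in cells_PiM (Suc k). g y = g' y"
    using completion_ex_borel_measurable[OF assms[unfolded cells_measure_def]] by blast
  have eq': "AE y in cells_measure (Suc k). g y = g' y"
    using eq by (simp add: AE_cells_measure)
  have *: "AE y in cells_measure k. (\<integral>\<^sup>+ t. g' (y(Suc k := t)) \<partial>cell_lebesgue) =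
      (\<integral>\<^sup>+ t. g (y(Suc k := t)) \<partial>cell_lebesgue)"
    using AE_cells_measure_Suc[OF eq'] by eventually_elim (rule nn_integral_cong_AE, simp add: eq_commute)
  have "integral\<^sup>N (cells_measure (Suc k)) g = integral\<^sup>N (cells_PiM (Suc k)) g'"
    unfolding nn_integral_cells_measure by (rule nn_integral_cong_AE) (rule eq)
  also have "\<dots> = (\<integral>\<^sup>+ y. (\<integral>\<^sup>+ t. g' (y(Suc k := t)) \<partial>cell_lebesgue) \<partial>cells_measure k)"
    unfolding nn_integral_cells_measure by (rule nn_integral_cells_PiM_Suc) fact
  also have "\<dots> = (\<integral>\<^sup>+ y. (\<integral>\<^sup>+ t. g (y(Suc k := t)) \<partial>cell_lebesgue) \<partial>cells_measure k)"
    using * by (rule nn_integral_cong_AE)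
  finally show ?eq .
  interpret C: complete_measure "cells_measure k :: (nat \<Rightarrow> real^'d) measure"
    by (rule complete_measure_cells_measure)
  have "(\<lambda>y. \<integral>\<^sup>+ t. g' (y(Suc k := t)) \<partial>cell_lebesgue) \<in> borel_measurable (cells_measure k)"
    unfolding cells_measure_def
    by (rule measurable_completion) (rule nn_integral_cells_PiM_Suc(2)[OF g'])
  then show ?meas
    using * by (rule C.measurable_AE_eq) simp
qed

text \<open>Measurability for the plain products does not by itself pass to completions: subsets of
  null sets must also have measurable preimages. \<open>AE_cells_measure_Suc_restrict\<close> shows
  that these preimages are null.\<close>

lemma measurable_restrict_cells_Suc:
  "(\<lambda>y. restrict y {1..k}) \<in> cells_measure (Suc k) \<rightarrow>\<^sub>M (cells_measure k :: (nat \<Rightarrow> real^'d) measure)"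
proof (rule measurableI)
  let ?r = "\<lambda>y::nat \<Rightarrow> real^'d. restrict y {1..k}"
  fix A :: "(nat \<Rightarrow> real^'d) set" assume "A \<in> sets (cells_measure k)"
  then obtain S N N' where A: "A = S \<union> N" "N \<subseteq> N'" "N' \<in> null_sets (cells_PiM k)" "S \<in> sets (cells_PiM k)"
    unfolding cells_measure_def by (rule sets_completionE)
  have r: "?r \<in> cells_PiM (Suc k) \<rightarrow>\<^sub>M cells_PiM k"
    by (rule measurable_restrict_subset) auto
  interpret C: complete_measure "cells_measure (Suc k) :: (nat \<Rightarrow> real^'d) measure"
    by (rule complete_measure_cells_measure)
  have "AE y in cells_measure k. y \<notin> N"
    unfolding AE_cells_measure using A by (intro AE_I'[of N']) auto
  then have "AE y in cells_measure (Suc k). ?r y \<notin> N"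
    by (rule AE_cells_measure_Suc_restrict)
  then have ae: "AE y in cells_measure (Suc k). y \<in> ?r -` S \<inter> space (cells_PiM (Suc k)) \<longleftrightarrow>
      y \<in> ?r -` A \<inter> space (cells_measure (Suc k))"
    by eventually_elim (auto simp: A(1))
  have "?r -` S \<inter> space (cells_PiM (Suc k)) \<in> sets (cells_measure (Suc k))"
    using measurable_sets[OF r A(4)] unfolding cells_measure_def by auto
  then show "?r -` A \<inter> space (cells_measure (Suc k)) \<in> sets (cells_measure (Suc k))"
    by (rule C.in_sets_AE[OF ae]) auto
qed (use restrict_in_cells[of _ "Suc k" k] in auto)

lemma measurable_restrict_cells:
  assumes "k \<le> n"
  shows "(\<lambda>y. restrict y {1..k}) \<in> cells_measure n \<rightarrow>\<^sub>M (cells_measure k :: (nat \<Rightarrow> real^'d) measure)"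
  using assms
proof (induction n rule: dec_induct)
  case base
  have "(\<lambda>y::nat \<Rightarrow> real^'d. restrict y {1..k}) \<in> cells_measure k \<rightarrow>\<^sub>M cells_measure k \<longleftrightarrow>
      (\<lambda>y::nat \<Rightarrow> real^'d. y) \<in> cells_measure k \<rightarrow>\<^sub>M cells_measure k"
    by (rule measurable_cong) (simp add: restrict_cells)
  then show ?case by (simp del: restrict_apply)
next
  case (step n)
  have "restrict (restrict y {1..n}) {1..k} = restrict y {1..k}" for y :: "nat \<Rightarrow> real^'d"
    using step.hyps by (auto simp: restrict_def fun_eq_iff)
  then show ?case
    using measurable_comp[OF measurable_restrict_cells_Suc step.IH]
    by (simp add: o_def del: restrict_apply)
qed

lemma measurable_last_cells_measure:
  fixes u :: "real^'d \<Rightarrow> 'b::topological_space"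
  assumes "u \<in> borel_measurable cell_lebesgue"
  shows "(\<lambda>y. u (y (Suc k))) \<in> borel_measurable (cells_measure (Suc k))"
  unfolding cells_measure_def
  by (intro measurable_completion measurable_compose[OF _ assms] measurable_component_singleton) simp


section \<open>Inequalities for p-th powers and for affine expressions in the extended reals\<close>

lemma norm_add_powr_le:
  fixes a b :: "'b::real_normed_vector"
  assumes "p > 0"
  shows "norm (a + b) powr p \<le> 2 powr p * (norm a powr p + norm b powr p)"
proof -
  \<comment> \<open>A sum of two norms is at most twice the larger one; this gives the constant
    \<open>2 powr p\<close> for every p > 0.\<close>
  have "norm (a + b) powr p \<le> (2 * max (norm a) (norm b)) powr p"
    using norm_triangle_ineq[of a b] assms by (intro powr_mono2) auto
  also have "\<dots> = 2 powr p * max (norm a) (norm b) powr p"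
    by (simp add: powr_mult)
  also have "\<dots> \<le> 2 powr p * (norm a powr p + norm b powr p)"
    by (intro mult_left_mono) (auto simp: max_def)
  finally show ?thesis .
qed

text \<open>Solving for \<open>h\<close> leaves a bound in which \<open>h\<close> no longer occurs,
  so that it passes to infima over \<open>h\<close>. Truncated subtraction keeps the equivalence
  valid for \<open>s\<close> below \<open>g\<close> and for infinite values.\<close>

lemma ennreal_le_affine_iff:
  assumes "c > 0"
  shows "s \<le> ennreal c * h + ennreal g \<longleftrightarrow> (s - ennreal g) / ennreal c \<le> h"
proof
  assume "s \<le> ennreal c * h + ennreal g"
  then have "s - ennreal g \<le> ennreal c * h"
    by (simp add: ennreal_minus_le_iff add.commute)
  then have "(s - ennreal g) / ennreal c \<le> ennreal c * h / ennreal c"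
    by (rule divide_right_mono_ennreal)
  also have "\<dots> = h"
    using assms by (subst mult.commute, subst ennreal_mult_divide_eq) auto
  finally show "(s - ennreal g) / ennreal c \<le> h" .
next
  assume "(s - ennreal g) / ennreal c \<le> h"
  then have "ennreal c * ((s - ennreal g) / ennreal c) \<le> ennreal c * h"
    by (rule mult_left_mono) simp
  also have "ennreal c * ((s - ennreal g) / ennreal c) = s - ennreal g"
    unfolding ennreal_times_divide using assms
    by (subst mult.commute, subst ennreal_mult_divide_eq) auto
  finally show "s \<le> ennreal c * h + ennreal g"
    by (simp add: ennreal_minus_le_iff add.commute)
qed

text \<open>The integral of a non-measurable function is the supremum over the simple functions below
  it, i.e. a lower integral, so no measurability of \<open>h\<close> is needed here.\<close>

lemma nn_integral_affine_le:
  fixes h :: "'a \<Rightarrow> ennreal" and g :: "'a \<Rightarrow> real"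
  assumes g: "g \<in> borel_measurable M" and c: "c > 0"
  shows "(\<integral>\<^sup>+ x. ennreal c * h x + ennreal (g x) \<partial>M)
    \<le> ennreal c * integral\<^sup>N M h + (\<integral>\<^sup>+ x. ennreal (g x) \<partial>M)"
  unfolding nn_integral_def[of M "\<lambda>x. ennreal c * h x + ennreal (g x)"]
proof (rule SUP_least)
  fix s assume "s \<in> {s. simple_function M s \<and> s \<le> (\<lambda>x. ennreal c * h x + ennreal (g x))}"
  then have s: "simple_function M s" and le: "\<And>x. s x \<le> ennreal c * h x + ennreal (g x)"
    by (auto simp: le_fun_def)
  note [measurable] = borel_measurable_simple_function[OF s] g
  \<comment> \<open>Solving the affine inequality for \<open>h\<close> turns a simple minorant of
    the combination into a measurable minorant of \<open>h\<close>, for which the integral is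
    additive.\<close>
  define s' where "s' x = (s x - ennreal (g x)) / ennreal c" for x
  have [measurable]: "s' \<in> borel_measurable M"
    unfolding s'_def by measurable
  have s'_le: "s' x \<le> h x" for x
    using le[of x] c by (simp add: s'_def ennreal_le_affine_iff)
  have le_s': "s x \<le> ennreal c * s' x + ennreal (g x)" for x
    using c by (simp add: s'_def ennreal_le_affine_iff)
  have "integral\<^sup>S M s = integral\<^sup>N M s"
    using s by (rule nn_integral_eq_simple_integral[symmetric])
  also have "\<dots> \<le> (\<integral>\<^sup>+ x. ennreal c * s' x + ennreal (g x) \<partial>M)"
    by (intro nn_integral_mono le_s')
  also have "\<dots> = ennreal c * integral\<^sup>N M s' + (\<integral>\<^sup>+ x. ennreal (g x) \<partial>M)"
    by (simp add: nn_integral_add nn_integral_cmult)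
  also have "\<dots> \<le> ennreal c * integral\<^sup>N M h + (\<integral>\<^sup>+ x. ennreal (g x) \<partial>M)"
    by (intro add_right_mono mult_left_mono nn_integral_mono s'_le) auto
  finally show "integral\<^sup>S M s \<le> ennreal c * integral\<^sup>N M h + (\<integral>\<^sup>+ x. ennreal (g x) \<partial>M)" .
qed


section \<open>Separability of L^p\<close>

text \<open>The p-th power of the L^p distance. Without the root the triangle inequality costs a
  factor \<open>2 powr p\<close>, which is harmless for questions of density.\<close>

definition Lp_dist_pow :: "real \<Rightarrow> 'a measure \<Rightarrow> ('a \<Rightarrow> 'b::euclidean_space) \<Rightarrow> ('a \<Rightarrow> 'b) \<Rightarrow> ennreal" where
  "Lp_dist_pow p M u v = (\<integral>\<^sup>+ x. ennreal (norm (u x - v x) powr p) \<partial>M)"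

lemma Lp_dist_pow_commute: "Lp_dist_pow p M u v = Lp_dist_pow p M v u"
  unfolding Lp_dist_pow_def by (simp add: norm_minus_commute)

lemma Lp_dist_pow_add:
  assumes [measurable]: "u \<in> borel_measurable M" "u' \<in> borel_measurable M"
    "v \<in> borel_measurable M" "v' \<in> borel_measurable M"
    and "p > 0"
  shows "Lp_dist_pow p M (\<lambda>x. u x + v x) (\<lambda>x. u' x + v' x)
    \<le> ennreal (2 powr p) * (Lp_dist_pow p M u u' + Lp_dist_pow p M v v')"
proof -
  have "Lp_dist_pow p M (\<lambda>x. u x + v x) (\<lambda>x. u' x + v' x) \<le>
      (\<integral>\<^sup>+ x. ennreal (2 powr p) * (ennreal (norm (u x - u' x) powr p) + ennreal (norm (v x - v' x) powr p)) \<partial>M)"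
    unfolding Lp_dist_pow_def
  proof (rule nn_integral_mono)
    fix x
    have "norm (u x + v x - (u' x + v' x)) powr p = norm ((u x - u' x) + (v x - v' x)) powr p"
      by (simp add: algebra_simps)
    also have "\<dots> \<le> 2 powr p * (norm (u x - u' x) powr p + norm (v x - v' x) powr p)"
      by (rule norm_add_powr_le) fact
    finally show "ennreal (norm (u x + v x - (u' x + v' x)) powr p) \<le> ennreal (2 powr p) *
        (ennreal (norm (u x - u' x) powr p) + ennreal (norm (v x - v' x) powr p))"
      by (simp add: ennreal_leI flip: ennreal_mult ennreal_plus)
  qed
  then show ?thesis
    unfolding Lp_dist_pow_def by (simp add: nn_integral_cmult nn_integral_add)
qed

lemma Lp_dist_pow_triangle:
  assumes [measurable]: "u \<in> borel_measurable M" "v \<in> borel_measurable M" "w \<in> borel_measurable M"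
    and "p > 0"
  shows "Lp_dist_pow p M u w \<le> ennreal (2 powr p) * (Lp_dist_pow p M u v + Lp_dist_pow p M v w)"
  \<comment> \<open>The sums u + v and v + w differ by u - w.\<close>
  using Lp_dist_pow_add[of u M v v w p] \<open>p > 0\<close> by (simp add: Lp_dist_pow_def)

text \<open>The tolerance for each of two terms that compensates the factor in
  \<open>Lp_dist_pow_triangle\<close>.\<close>

lemma ennreal_powr_mult_add_less:
  fixes a b :: ennreal
  assumes "a < ennreal (\<delta> / (2 * 2 powr p))" "b < ennreal (\<delta> / (2 * 2 powr p))"
  shows "ennreal (2 powr p) * (a + b) < ennreal \<delta>"
proof -
  obtain r where r: "a = ennreal r" "0 \<le> r"
    using assms(1) by (cases a) auto
  obtain s where s: "b = ennreal s" "0 \<le> s"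
    using assms(2) by (cases b) auto
  have "2 powr p * (r + s) < \<delta>"
    using assms r s by (simp add: ennreal_less_iff field_simps)
  then show ?thesis
    using r s by (simp add: ennreal_less_iff flip: ennreal_mult ennreal_plus)
qed

definition Lp_closure :: "real \<Rightarrow> 'a measure \<Rightarrow> ('a \<Rightarrow> 'b::euclidean_space) set \<Rightarrow> ('a \<Rightarrow> 'b) set" where
  "Lp_closure p M G = {u \<in> borel_measurable M. \<forall>\<delta>>0. \<exists>g\<in>G. Lp_dist_pow p M u g < ennreal \<delta>}"

lemma Lp_closure_closed:
  assumes G: "G \<subseteq> borel_measurable M" and u: "u \<in> borel_measurable M" and "p > 0"
    and ex: "\<And>\<delta>. \<delta> > 0 \<Longrightarrow> \<exists>v\<in>Lp_closure p M G. Lp_dist_pow p M u v < ennreal \<delta>"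
  shows "u \<in> Lp_closure p M G"
  unfolding Lp_closure_def
proof (intro CollectI conjI allI impI u)
  fix \<delta> :: real assume "\<delta> > 0"
  then have \<delta>': "\<delta> / (2 * 2 powr p) > 0" by simp
  from ex[OF this] obtain v where v: "v \<in> Lp_closure p M G"
      "Lp_dist_pow p M u v < ennreal (\<delta> / (2 * 2 powr p))" by blast
  then obtain g where g: "g \<in> G" "Lp_dist_pow p M v g < ennreal (\<delta> / (2 * 2 powr p))"
    using \<delta>' by (auto simp: Lp_closure_def)
  have "Lp_dist_pow p M u g \<le> ennreal (2 powr p) * (Lp_dist_pow p M u v + Lp_dist_pow p M v g)"
    using u v g G \<open>p > 0\<close> by (intro Lp_dist_pow_triangle) (auto simp: Lp_closure_def)
  also have "\<dots> < ennreal \<delta>"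
    using v g by (intro ennreal_powr_mult_add_less)
  finally show "\<exists>g\<in>G. Lp_dist_pow p M u g < ennreal \<delta>"
    using g by blast
qed

lemma Lp_closure_add:
  assumes G: "G \<subseteq> borel_measurable M" and "p > 0"
    and add: "\<And>g g'. g \<in> G \<Longrightarrow> g' \<in> G \<Longrightarrow> (\<lambda>x. g x + g' x) \<in> G"
    and u: "u \<in> Lp_closure p M G" and v: "v \<in> Lp_closure p M G"
  shows "(\<lambda>x. u x + v x) \<in> Lp_closure p M G"
  unfolding Lp_closure_def
proof (intro CollectI conjI allI impI)
  show "(\<lambda>x. u x + v x) \<in> borel_measurable M"
    using u v by (auto simp: Lp_closure_def)
  fix \<delta> :: real assume "\<delta> > 0"
  then have \<delta>': "\<delta> / (2 * 2 powr p) > 0" by simp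
  obtain g where g: "g \<in> G" "Lp_dist_pow p M u g < ennreal (\<delta> / (2 * 2 powr p))"
    using \<delta>' u by (auto simp: Lp_closure_def)
  obtain g' where g': "g' \<in> G" "Lp_dist_pow p M v g' < ennreal (\<delta> / (2 * 2 powr p))"
    using \<delta>' v by (auto simp: Lp_closure_def)
  have "Lp_dist_pow p M (\<lambda>x. u x + v x) (\<lambda>x. g x + g' x)
      \<le> ennreal (2 powr p) * (Lp_dist_pow p M u g + Lp_dist_pow p M v g')"
    using u v g g' G \<open>p > 0\<close> by (intro Lp_dist_pow_add) (auto simp: Lp_closure_def)
  also have "\<dots> < ennreal \<delta>"
    using g g' by (intro ennreal_powr_mult_add_less)
  finally show "\<exists>g\<in>G. Lp_dist_pow p M (\<lambda>x. u x + v x) g < ennreal \<delta>"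
    using add g g' by blast
qed

lemma Lp_closure_sum:
  assumes G: "G \<subseteq> borel_measurable M" and "p > 0"
    and zero: "(\<lambda>_. 0 :: 'b::euclidean_space) \<in> G"
    and add: "\<And>g g'. g \<in> G \<Longrightarrow> g' \<in> G \<Longrightarrow> (\<lambda>x. g x + g' x) \<in> G"
    and "finite I" and "\<And>i. i \<in> I \<Longrightarrow> u i \<in> Lp_closure p M G"
  shows "(\<lambda>x. \<Sum>i\<in>I. u i x) \<in> Lp_closure p M G"
  using assms(5,6)
proof (induction I rule: finite_induct)
  case empty
  have "Lp_dist_pow p M (\<lambda>_. 0) (\<lambda>_. 0 :: 'b) = 0"
    by (simp add: Lp_dist_pow_def)
  then have "\<exists>g\<in>G. Lp_dist_pow p M (\<lambda>_. 0) g < ennreal \<delta>" if "\<delta> > 0" for \<delta>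
    using zero that by (intro bexI[of _ "\<lambda>_. 0"]) simp
  then show ?case
    by (simp add: Lp_closure_def)
next
  case (insert i I)
  have "(\<lambda>x. u i x + (\<Sum>i\<in>I. u i x)) \<in> Lp_closure p M G"
  proof (rule Lp_closure_add[OF G \<open>p > 0\<close>])
    show "(\<lambda>x. g x + g' x) \<in> G" if "g \<in> G" "g' \<in> G" for g g'
      using that by (rule add)
    show "u i \<in> Lp_closure p M G"
      using insert.prems by simp
    show "(\<lambda>x. \<Sum>i\<in>I. u i x) \<in> Lp_closure p M G"
      using insert.prems by (intro insert.IH) simp
  qed
  with insert.hyps show ?case by simp
qed

lemma Lp_closure_simple_function:
  assumes G: "G \<subseteq> borel_measurable M" and "p > 0"
    and zero: "(\<lambda>_. 0) \<in> G"
    and add: "\<And>g g'. g \<in> G \<Longrightarrow> g' \<in> G \<Longrightarrow> (\<lambda>x. g x + g' x) \<in> G"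
    and ind: "\<And>A c. A \<in> sets M \<Longrightarrow> (\<lambda>x. indicator A x *\<^sub>R c) \<in> Lp_closure p M G"
    and s: "simple_function M s"
  shows "s \<in> Lp_closure p M G"
proof -
  have fin: "finite (s ` space M)"
    using s by (rule simple_functionD)
  have "(\<lambda>x. \<Sum>c\<in>s ` space M. indicator (s -` {c} \<inter> space M) x *\<^sub>R c) \<in> Lp_closure p M G"
    using fin s by (intro Lp_closure_sum[OF G \<open>p > 0\<close> zero add] ind) (auto intro: simple_functionD)
  moreover have "(\<Sum>c\<in>s ` space M. indicator (s -` {c} \<inter> space M) x *\<^sub>R c) = s x"
    if "x \<in> space M" for x
  proof -
    have "(\<Sum>c\<in>s ` space M. indicator (s -` {c} \<inter> space M) x *\<^sub>R c) = (\<Sum>c\<in>s ` space M. if c = s x then c else 0)"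
      using that by (intro sum.cong) (auto simp: indicator_def)
    also have "\<dots> = s x"
      using fin that by simp
    finally show ?thesis .
  qed
  \<comment> \<open>The representation by level sets holds on \<open>space M\<close> only, and the
    distance sees no other points.\<close>
  moreover have "Lp_dist_pow p M s g = Lp_dist_pow p M (\<lambda>x. \<Sum>c\<in>s ` space M. indicator (s -` {c} \<inter> space M) x *\<^sub>R c) g" for g
    unfolding Lp_dist_pow_def using calculation(2) by (intro nn_integral_cong) simp
  ultimately show ?thesis
    using borel_measurable_simple_function[OF s] by (simp add: Lp_closure_def)
qed

text \<open>Simple functions converge pointwise to \<open>u\<close> while bounded by 2|u|. The p-th
  powers of the differences are thus dominated by 3^p |u|^p, and dominated convergence
  applies.\<close>

lemma Lp_closure_eq:
  assumes G: "G \<subseteq> borel_measurable M" and "p > 0"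
    and simple: "\<And>s. simple_function M s \<Longrightarrow> s \<in> Lp_closure p M G"
    and u: "u \<in> borel_measurable M" and fin: "(\<integral>\<^sup>+ x. ennreal (norm (u x) powr p) \<partial>M) < \<infinity>"
  shows "u \<in> Lp_closure p M G"
proof (rule Lp_closure_closed[OF G u \<open>p > 0\<close>])
  fix \<delta> :: real assume "\<delta> > 0"
  obtain s where s: "\<And>i. simple_function M (s i)" "\<And>x. x \<in> space M \<Longrightarrow> (\<lambda>i. s i x) \<longlonglongrightarrow> u x"
    "\<And>i x. x \<in> space M \<Longrightarrow> norm (s i x) \<le> 2 * norm (u x)"
    using borel_measurable_implies_sequence_metric[OF u, of 0] unfolding dist_norm diff_zero
    by blast
  note [measurable] = borel_measurable_simple_function[OF s(1)] u
  have "(\<lambda>i. \<integral>\<^sup>+ x. ennreal (norm (u x - s i x) powr p) \<partial>M) \<longlonglongrightarrow> (\<integral>\<^sup>+ x. 0 \<partial>M)"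
  proof (rule nn_integral_dominated_convergence)
    show "(\<integral>\<^sup>+ x. ennreal (3 powr p) * ennreal (norm (u x) powr p) \<partial>M) < \<infinity>"
      using fin by (simp add: nn_integral_cmult ennreal_mult_less_top)
    show "AE x in M. ennreal (norm (u x - s i x) powr p) \<le> ennreal (3 powr p) * ennreal (norm (u x) powr p)" for i
    proof (rule AE_I2)
      fix x assume "x \<in> space M"
      then have "norm (u x - s i x) \<le> 3 * norm (u x)"
        using s(3)[of x i] norm_triangle_ineq4[of "u x" "s i x"] by simp
      then have "norm (u x - s i x) powr p \<le> (3 * norm (u x)) powr p"
        using \<open>p > 0\<close> by (intro powr_mono2) auto
      then show "ennreal (norm (u x - s i x) powr p) \<le> ennreal (3 powr p) * ennreal (norm (u x) powr p)"
        by (simp add: powr_mult ennreal_leI flip: ennreal_mult)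
    qed
    show "AE x in M. (\<lambda>i. ennreal (norm (u x - s i x) powr p)) \<longlonglongrightarrow> 0"
    proof (rule AE_I2)
      fix x assume "x \<in> space M"
      then have "(\<lambda>i. norm (u x - s i x)) \<longlonglongrightarrow> 0"
        using tendsto_norm[OF tendsto_diff[OF tendsto_const[of "u x"] s(2)[of x]]] by simp
      then have "(\<lambda>i. norm (u x - s i x) powr p) \<longlonglongrightarrow> 0 powr p"
        using \<open>p > 0\<close> by (intro tendsto_powr') auto
      then show "(\<lambda>i. ennreal (norm (u x - s i x) powr p)) \<longlonglongrightarrow> 0"
        using tendsto_ennrealI by fastforce
    qed
  qed measurable
  then have "\<forall>\<^sub>F i in sequentially. Lp_dist_pow p M u (s i) < ennreal \<delta>"
    using \<open>\<delta> > 0\<close> by (intro order_tendstoD(2)[where y = 0]) (auto simp: Lp_dist_pow_def)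
  then obtain i where "Lp_dist_pow p M u (s i) < ennreal \<delta>"
    by (auto simp: eventually_sequentially)
  with simple[OF s(1)] show "\<exists>v\<in>Lp_closure p M G. Lp_dist_pow p M u v < ennreal \<delta>"
    by blast
qed

text \<open>Outer regularity encloses \<open>A\<close> in an open set with small excess. That set is
  the increasing union of finite unions of its basic subsets, and continuity from above, valid since
  \<open>S\<close> has finite measure, makes one of them miss little of \<open>A\<close>. Only
  countably many finite unions can occur.\<close>

lemma ex_finite_basis_union_approx:
  fixes b :: "nat \<Rightarrow> 'a::euclidean_space set"
  assumes b: "topological_basis (range b)" and S: "S \<in> lmeasurable"
    and A: "A \<in> sets (lebesgue_on S)" and "e > 0"
  shows "\<exists>xs. emeasure (lebesgue_on S)
      ((A - (\<Union>i\<in>set xs. b i)) \<union> ((\<Union>i\<in>set xs. b i) \<inter> S - A)) < ennreal e"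
proof -
  let ?M = "lebesgue_on S"
  have mS: "S \<in> sets lebesgue" using S by auto
  have mA: "A \<in> sets lebesgue" "A \<subseteq> S"
    using A by (simp_all add: sets_restrict_space_iff mS)
  obtain T where T: "open T" "A \<subseteq> T" "emeasure lebesgue (T - A) < ennreal (e / 2)"
    by (rule sets_lebesgue_outer_open[OF mA(1) half_gt_zero[OF \<open>e > 0\<close>]])
  define V where "V N = (\<Union>i\<in>{i. b i \<subseteq> T \<and> i < N}. b i)" for N
  have oV: "open (V N)" for N
    using b unfolding V_def by (auto simp: topological_basis_open)
  have VT: "V N \<subseteq> T" for N unfolding V_def by auto
  have UV: "(\<Union>N. V N) = T"
  proof (intro equalityI subsetI)
    fix x assume "x \<in> T"
    then obtain i where "x \<in> b i" "b i \<subseteq> T"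
      using topological_basisE[OF b T(1)] by (metis rangeE)
    then have "x \<in> V (Suc i)"
      unfolding V_def by blast
    then show "x \<in> (\<Union>N. V N)"
      by blast
  qed (use VT in auto)
  have mes: "X \<inter> S \<in> sets ?M" "A - X \<in> sets ?M" if "X \<in> sets borel" for X
    using that mS mA by (auto simp: sets_restrict_space_iff)
  have "(\<lambda>N. emeasure ?M (A - V N)) \<longlonglongrightarrow> emeasure ?M (\<Inter>N. A - V N)"
  proof (rule Lim_emeasure_decseq)
    show "range (\<lambda>N. A - V N) \<subseteq> sets ?M"
      using mes(2) oV by auto
    show "decseq (\<lambda>N. A - V N)"
      unfolding V_def decseq_def by fastforce
    show "emeasure ?M (A - V N) \<noteq> \<infinity>" for N
    proof -
      have "emeasure ?M (A - V N) \<le> emeasure ?M (space ?M)"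
        by (rule emeasure_space)
      also have "\<dots> < \<infinity>"
        using S mS by (simp add: emeasure_restrict_space space_restrict_space fmeasurable_def)
      finally show ?thesis by simp
    qed
  qed
  moreover have "(\<Inter>N. A - V N) = {}"
    using UV T(2) by auto
  ultimately have "(\<lambda>N. emeasure ?M (A - V N)) \<longlonglongrightarrow> 0"
    by (simp only: emeasure_empty)
  then have "\<forall>\<^sub>F N in sequentially. emeasure ?M (A - V N) < ennreal (e / 2)"
    using \<open>e > 0\<close> by (intro order_tendstoD(2)) auto
  then obtain N where N: "emeasure ?M (A - V N) < ennreal (e / 2)"
    by (auto simp: eventually_sequentially)
  define xs where "xs = filter (\<lambda>i. b i \<subseteq> T) [0..<N]"
  have xs: "(\<Union>i\<in>set xs. b i) = V N"
    unfolding xs_def V_def by auto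
  have "emeasure ?M (V N \<inter> S - A) = emeasure lebesgue (V N \<inter> S - A)"
    using mS by (intro emeasure_restrict_space) auto
  also have "\<dots> \<le> emeasure lebesgue (T - A)"
    using VT T mA by (intro emeasure_mono) auto
  finally have le: "emeasure ?M (V N \<inter> S - A) \<le> emeasure lebesgue (T - A)" .
  have "emeasure ?M ((A - V N) \<union> (V N \<inter> S - A)) \<le> emeasure ?M (A - V N) + emeasure ?M (V N \<inter> S - A)"
    using mes oV A by (intro emeasure_subadditive) auto
  also have "\<dots> \<le> emeasure ?M (A - V N) + emeasure lebesgue (T - A)"
    by (intro add_left_mono le)
  also have "\<dots> < ennreal (e / 2) + ennreal (e / 2)"
    using N T(3) by (intro add_strict_mono)
  also have "\<dots> = ennreal e"
    using \<open>e > 0\<close> by (simp flip: ennreal_plus)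
  finally show ?thesis
    by (intro exI[of _ xs]) (simp only: xs)
qed

text \<open>The dense family consists of finite sums of indicators of finite unions of basic sets,
  with coefficients in a countable dense set \<open>Q\<close>. Coding the sums by lists makes
  countability and closure under addition immediate. The closure then grows in stages: arbitrary
  coefficients, arbitrary measurable sets, simple functions, L^p.\<close>

proposition Lp_separable:
  fixes S :: "'a::euclidean_space set"
  assumes S: "S \<in> lmeasurable" and "p > 0"
  shows "\<exists>G. countable G \<and> G \<subseteq> borel_measurable (lebesgue_on S) \<and>
    (\<forall>u::'a \<Rightarrow> 'b::euclidean_space. u \<in> borel_measurable (lebesgue_on S) \<longrightarrow>
      (\<integral>\<^sup>+ x. ennreal (norm (u x) powr p) \<partial>lebesgue_on S) < \<infinity> \<longrightarrow> u \<in> Lp_closure p (lebesgue_on S) G)"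
proof -
  let ?M = "lebesgue_on S"
  have mS: "S \<in> sets lebesgue" using S by auto
  obtain B :: "'a set set" where B: "countable B" "topological_basis B"
    using ex_countable_basis by blast
  have "B \<noteq> {}"
    using B(2) by (metis UNIV_I empty_iff open_UNIV topological_basisE)
  define b where "b = from_nat_into B"
  have b: "topological_basis (range b)"
    using B range_from_nat_into[OF \<open>B \<noteq> {}\<close> B(1)] by (simp add: b_def)
  obtain Q :: "'b set" where Q: "countable Q" "\<And>X. open X \<Longrightarrow> X \<noteq> {} \<Longrightarrow> \<exists>d\<in>Q. d \<in> X"
    using countable_dense_setE by blast
  define V where "V xs = (\<Union>i\<in>set xs. b i)" for xs
  have oV: "open (V xs)" for xs
    using b unfolding V_def by (auto simp: topological_basis_open)
  define g :: "(nat list \<times> 'b) list \<Rightarrow> 'a \<Rightarrow> 'b"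
    where "g l x = (\<Sum>(xs, c)\<leftarrow>l. indicator (V xs) x *\<^sub>R c)" for l and x
  define G where "G = g ` lists (UNIV \<times> Q)"
  have g_simps: "g [] = (\<lambda>_. 0)" "g ((xs, c) # l) = (\<lambda>x. indicator (V xs) x *\<^sub>R c + g l x)" for xs c l
    by (auto simp: g_def)
  have g_append: "g (l @ l') x = g l x + g l' x" for l l' x
    by (simp add: g_def)
  have mV: "indicat_real (V xs) \<in> borel_measurable ?M" for xs
    by (intro measurable_restrict_space1 measurable_completion borel_measurable_indicator) (use oV in auto)
  have "g l \<in> borel_measurable ?M" for l
  proof (induction l)
    case (Cons a l)
    then show ?case
      using mV by (cases a) (auto simp: g_simps intro!: borel_measurable_add borel_measurable_scaleR)
  qed (simp add: g_simps)
  then have G: "G \<subseteq> borel_measurable ?M"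
    by (auto simp: G_def)
  have cG: "countable G"
    unfolding G_def using Q(1) by (intro countable_image countable_lists countable_SIGMA) auto
  have zero: "(\<lambda>_. 0) \<in> G"
    unfolding G_def g_simps(1)[symmetric] by (intro imageI) auto
  have add: "(\<lambda>x. h x + h' x) \<in> G" if hh': "h \<in> G" "h' \<in> G" for h h'
  proof -
    obtain l l' where "h = g l" "h' = g l'" "l \<in> lists (UNIV \<times> Q)" "l' \<in> lists (UNIV \<times> Q)"
      using hh' unfolding G_def by blast
    then show ?thesis
      unfolding G_def by (intro image_eqI[of _ _ "l @ l'"]) (auto simp: g_append fun_eq_iff)
  qed
  have VQ: "(\<lambda>x. indicator (V xs) x *\<^sub>R c) \<in> G" if "c \<in> Q" for xs c
    unfolding G_def using that by (intro image_eqI[of _ _ "[(xs, c)]"]) (auto simp: g_simps)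
  define m where "m = measure lebesgue S"
  have m: "emeasure ?M S = ennreal m" "0 \<le> m"
    using emeasure_restrict_space[of S lebesgue S] mS by (simp_all add: m_def emeasure_eq_measure2[OF S])
  have V: "(\<lambda>x. indicator (V xs) x *\<^sub>R c) \<in> Lp_closure p ?M G" for xs c
    unfolding Lp_closure_def
  proof (intro CollectI conjI allI impI)
    show "(\<lambda>x. indicator (V xs) x *\<^sub>R c) \<in> borel_measurable ?M"
      using mV by auto
    fix \<delta> :: real assume "\<delta> > 0"
    \<comment> \<open>The p-th power of \<open>\<eta>\<close> is \<open>\<delta> / (m + 1)\<close>,
      so integrating over a set of measure \<open>m\<close> stays strictly below
      \<open>\<delta>\<close>, also for m = 0.\<close>
    define \<eta> where "\<eta> = (\<delta> / (m + 1)) powr (1 / p)"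
    have \<eta>: "\<eta> > 0" using \<open>\<delta> > 0\<close> m(2) by (simp add: \<eta>_def)
    then obtain q where q: "q \<in> Q" "q \<in> ball c \<eta>"
      using Q(2)[of "ball c \<eta>"] by auto
    have "Lp_dist_pow p ?M (\<lambda>x. indicator (V xs) x *\<^sub>R c) (\<lambda>x. indicator (V xs) x *\<^sub>R q)
        \<le> (\<integral>\<^sup>+ x. ennreal (\<delta> / (m + 1)) \<partial>?M)"
      unfolding Lp_dist_pow_def
    proof (rule nn_integral_mono, rule ennreal_leI)
      fix x
      have "norm (indicator (V xs) x *\<^sub>R c - indicator (V xs) x *\<^sub>R q) \<le> norm (c - q)"
        by (auto simp: indicator_def)
      then have "norm (indicator (V xs) x *\<^sub>R c - indicator (V xs) x *\<^sub>R q) powr p \<le> \<eta> powr p"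
        using q \<open>p > 0\<close> by (intro powr_mono2) (auto simp: dist_norm)
      also have "\<eta> powr p = \<delta> / (m + 1)"
        using \<open>p > 0\<close> \<open>\<delta> > 0\<close> m(2) by (simp add: \<eta>_def powr_powr)
      finally show "norm (indicator (V xs) x *\<^sub>R c - indicator (V xs) x *\<^sub>R q) powr p \<le> \<delta> / (m + 1)" .
    qed
    also have "\<dots> = ennreal (\<delta> / (m + 1) * m)"
      using m(1) ennreal_mult''[OF m(2), of "\<delta> / (m + 1)"] by (simp add: space_restrict_space)
    also have "\<dots> < ennreal \<delta>"
    proof (rule ennreal_lessI)
      show "\<delta> / (m + 1) * m < \<delta>"
        using m(2) \<open>\<delta> > 0\<close> by (simp add: field_simps)
    qed fact
    finally show "\<exists>g\<in>G. Lp_dist_pow p ?M (\<lambda>x. indicator (V xs) x *\<^sub>R c) g < ennreal \<delta>"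
      using VQ[OF q(1)] by blast
  qed
  have A: "(\<lambda>x. indicator A x *\<^sub>R c) \<in> Lp_closure p ?M G" if mA: "A \<in> sets ?M" for A c
  proof (rule Lp_closure_closed[OF G _ \<open>p > 0\<close>])
    show "(\<lambda>x. indicator A x *\<^sub>R c) \<in> borel_measurable ?M"
      using mA by auto
    fix \<delta> :: real assume "\<delta> > 0"
    \<comment> \<open>The summand 1 covers c = 0 and makes the final inequality strict.\<close>
    define e where "e = \<delta> / (norm c powr p + 1)"
    have e: "e > 0" using \<open>\<delta> > 0\<close> by (simp add: e_def add_nonneg_pos)
    obtain xs where xs: "emeasure ?M ((A - V xs) \<union> (V xs \<inter> S - A)) < ennreal e"
      using ex_finite_basis_union_approx[OF b S mA e] unfolding V_def by blast
    let ?E = "(A - V xs) \<union> (V xs \<inter> S - A)"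
    have "V xs \<in> sets lebesgue" using oV by auto
    moreover have A: "A \<in> sets lebesgue" "A \<subseteq> S"
      using mA by (simp_all add: sets_restrict_space_iff mS)
    ultimately have "?E \<in> sets lebesgue"
      using mS by (intro sets.Un sets.Diff sets.Int)
    then have mE: "?E \<in> sets ?M"
      using A(2) by (subst sets_restrict_space_iff) (auto simp: mS)
    have "Lp_dist_pow p ?M (\<lambda>x. indicator A x *\<^sub>R c) (\<lambda>x. indicator (V xs) x *\<^sub>R c)
        \<le> (\<integral>\<^sup>+ x. ennreal (norm c powr p) * indicator ?E x \<partial>?M)"
      unfolding Lp_dist_pow_def
    proof (rule nn_integral_mono)
      fix x assume "x \<in> space ?M"
      then have "x \<in> S" by (simp add: space_restrict_space)
      then show "ennreal (norm (indicator A x *\<^sub>R c - indicator (V xs) x *\<^sub>R c) powr p)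
          \<le> ennreal (norm c powr p) * indicator ?E x"
        by (cases "x \<in> A"; cases "x \<in> V xs") simp_all
    qed
    also have "\<dots> = ennreal (norm c powr p) * emeasure ?M ?E"
      using mE by (rule nn_integral_cmult_indicator)
    also have "\<dots> \<le> ennreal (norm c powr p) * ennreal e"
      using xs by (intro mult_left_mono) auto
    also have "\<dots> = ennreal (norm c powr p * e)"
      by (simp add: ennreal_mult')
    also have "\<dots> < ennreal \<delta>"
    proof (rule ennreal_lessI)
      have "norm c powr p + 1 > 0" by (simp add: add_nonneg_pos)
      then show "norm c powr p * e < \<delta>"
        using \<open>\<delta> > 0\<close> by (simp add: e_def field_simps)
    qed fact
    finally show "\<exists>v\<in>Lp_closure p ?M G. Lp_dist_pow p ?M (\<lambda>x. indicator A x *\<^sub>R c) v < ennreal \<delta>"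
      using V by blast
  qed
  have "s \<in> Lp_closure p ?M G" if "simple_function ?M s" for s
    by (rule Lp_closure_simple_function[OF G \<open>p > 0\<close> zero add A that])
  then have "u \<in> Lp_closure p ?M G" if "u \<in> borel_measurable ?M"
      "(\<integral>\<^sup>+ x. ennreal (norm (u x) powr p) \<partial>?M) < \<infinity>" for u
    using Lp_closure_eq[OF G \<open>p > 0\<close> _ that] by blast
  with cG G show ?thesis by blast
qed

text \<open>Separability passes to subsets, but the approximating functions in \<open>G\<close> may
  lie outside the family. Each \<open>g\<close> and each radius 1/(k+1) is therefore assigned a
  member of the family that close to \<open>g\<close>, if there is one. The sequence consists of
  indices because a corrector, and not just its gradient, has to be recovered.\<close>

corollary Lp_separable_family:
  fixes U :: "'i \<Rightarrow> 'a::euclidean_space \<Rightarrow> 'b::euclidean_space"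
  assumes S: "S \<in> lmeasurable" and "p > 0" and "I \<noteq> {}"
    and meas: "\<And>i. i \<in> I \<Longrightarrow> U i \<in> borel_measurable (lebesgue_on S)"
    and fin: "\<And>i. i \<in> I \<Longrightarrow> (\<integral>\<^sup>+ x. ennreal (norm (U i x) powr p) \<partial>lebesgue_on S) < \<infinity>"
  obtains \<psi> :: "nat \<Rightarrow> 'i" where "range \<psi> \<subseteq> I"
    and "\<And>i \<delta>. i \<in> I \<Longrightarrow> \<delta> > 0 \<Longrightarrow> \<exists>j. Lp_dist_pow p (lebesgue_on S) (U i) (U (\<psi> j)) < ennreal \<delta>"
proof -
  let ?d = "Lp_dist_pow p (lebesgue_on S)"
  obtain G :: "('a \<Rightarrow> 'b) set" where G: "countable G" "G \<subseteq> borel_measurable (lebesgue_on S)"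
    "\<And>u. u \<in> borel_measurable (lebesgue_on S) \<Longrightarrow>
      (\<integral>\<^sup>+ x. ennreal (norm (u x) powr p) \<partial>lebesgue_on S) < \<infinity> \<Longrightarrow> u \<in> Lp_closure p (lebesgue_on S) G"
    using Lp_separable[OF S \<open>p > 0\<close>] by blast
  define close where "close i g k \<longleftrightarrow> ?d (U i) g < ennreal (1 / real (Suc k))" for i g k
  \<comment> \<open>If no member is close to \<open>g\<close>, the choice falls on an arbitrary one,
    so \<open>near\<close> always takes values in \<open>I\<close>.\<close>
  define near where "near = (\<lambda>(g, k). SOME i. i \<in> I \<and> ((\<exists>j\<in>I. close j g k) \<longrightarrow> close i g k))"
  have near_ex: "near (g, k) \<in> I \<and> ((\<exists>j\<in>I. close j g k) \<longrightarrow> close (near (g, k)) g k)" for g k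
    unfolding near_def prod.case by (rule someI_ex) (use \<open>I \<noteq> {}\<close> in blast)
  have near: "near (g, k) \<in> I" "(\<exists>i\<in>I. ?d (U i) g < ennreal (1 / real (Suc k))) \<Longrightarrow>
      ?d (U (near (g, k))) g < ennreal (1 / real (Suc k))" for g k
    using near_ex[of g k] unfolding close_def by blast+
  define C where "C = near ` (G \<times> UNIV)"
  have "G \<noteq> {}"
  proof -
    obtain i where "i \<in> I" using \<open>I \<noteq> {}\<close> by blast
    then have "U i \<in> Lp_closure p (lebesgue_on S) G" using G(3) meas fin by blast
    then show ?thesis unfolding Lp_closure_def using zero_less_one by blast
  qed
  then have C: "countable C" "C \<noteq> {}" "C \<subseteq> I"
    unfolding C_def using G(1) near(1) by (auto intro!: countable_image countable_SIGMA)
  show ?thesis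
  proof (rule that)
    show "range (from_nat_into C) \<subseteq> I"
      using range_from_nat_into[OF C(2,1)] C(3) by simp
    fix i and \<delta> :: real assume i: "i \<in> I" and "\<delta> > 0"
    then have \<delta>': "\<delta> / (2 * 2 powr p) > 0" by simp
    then obtain k where k: "1 / real (Suc k) < \<delta> / (2 * 2 powr p)"
      using nat_approx_posE by (metis of_nat_Suc)
    have "U i \<in> Lp_closure p (lebesgue_on S) G"
      using G(3) meas fin i by blast
    then obtain g where g: "g \<in> G" "?d (U i) g < ennreal (1 / real (Suc k))"
      unfolding Lp_closure_def by (auto dest!: spec[of _ "1 / real (Suc k)"])
    let ?j = "near (g, k)"
    have lt: "ennreal (1 / real (Suc k)) < ennreal (\<delta> / (2 * 2 powr p))"
      using k by (intro ennreal_lessI \<delta>')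
    have "?d (U i) (U ?j) \<le> ennreal (2 powr p) * (?d (U i) g + ?d g (U ?j))"
      using i g(1) G(2) near(1) meas \<open>p > 0\<close> by (intro Lp_dist_pow_triangle) auto
    also have "\<dots> < ennreal \<delta>"
    proof (rule ennreal_powr_mult_add_less)
      show "?d (U i) g < ennreal (\<delta> / (2 * 2 powr p))"
        using g(2) lt by (rule less_trans)
      have "?d (U ?j) g < ennreal (1 / real (Suc k))"
        using near(2) g(2) i by blast
      then show "?d g (U ?j) < ennreal (\<delta> / (2 * 2 powr p))"
        using lt by (subst Lp_dist_pow_commute) (rule less_trans)
    qed
    finally have "?d (U i) (U ?j) < ennreal \<delta>" .
    moreover have "?j \<in> C" using g(1) by (auto simp: C_def)
    then obtain j where "from_nat_into C j = ?j"
      using range_from_nat_into[OF C(2,1)] by (metis rangeE)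
    ultimately show "\<exists>j. ?d (U i) (U (from_nat_into C j)) < ennreal \<delta>"
      by (intro exI[of _ j]) simp
  qed
qed


section \<open>Gradients of periodic Sobolev functions\<close>

lemma weak_gradient_measurable:
  "\<phi> \<in> W1p_per p \<Longrightarrow> weak_gradient \<phi> \<in> borel_measurable cell_lebesgue"
  by (rule measurable_cell_lebesgue) (simp add: W1p_per_def Lp_loc_def)

text \<open>The half-open cell is not compact, but it lies in a compact cube.\<close>

lemma Lp_loc_cell_finite:
  fixes u :: "real^'d \<Rightarrow> 'b::euclidean_space"
  assumes "u \<in> Lp_loc p"
  shows "(\<integral>\<^sup>+ t. ennreal (norm (u t) powr p) \<partial>cell_lebesgue) < \<infinity>"
proof -
  let ?K = "cbox 0 (\<chi> i. 1) :: (real^'d) set"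
  have "unit_cell \<subseteq> ?K"
    by (auto simp: unit_cell_def mem_box_cart less_imp_le)
  then have "(\<integral>\<^sup>+ t. ennreal (norm (u t) powr p) \<partial>cell_lebesgue) \<le>
      (\<integral>\<^sup>+ t\<in>?K. ennreal (norm (u t) powr p) \<partial>lebesgue)"
    by (subst nn_integral_restrict_space)
      (auto simp: unit_cell_measurable intro!: nn_integral_mono split: split_indicator)
  also have "\<dots> < \<infinity>"
    using assms by (simp add: Lp_loc_def)
  finally show ?thesis .
qed

lemma weak_gradient_cell_finite:
  "\<phi> \<in> W1p_per p \<Longrightarrow> (\<integral>\<^sup>+ t. ennreal (norm (weak_gradient \<phi> t) powr p) \<partial>cell_lebesgue) < \<infinity>"
  by (rule Lp_loc_cell_finite) (simp add: W1p_per_def)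

lemma W1p_norm_pow_finite: "\<phi> \<in> W1p_per p \<Longrightarrow> W1p_norm_pow p \<phi> < \<infinity>"
proof -
  assume \<phi>: "\<phi> \<in> W1p_per p"
  have [measurable]: "\<phi> \<in> borel_measurable cell_lebesgue"
    using \<phi> by (intro measurable_cell_lebesgue) (simp add: W1p_per_def Lp_loc_def)
  note [measurable] = weak_gradient_measurable[OF \<phi>]
  have "W1p_norm_pow p \<phi> = (\<integral>\<^sup>+ t. ennreal (norm (\<phi> t) powr p) \<partial>cell_lebesgue)
      + (\<integral>\<^sup>+ t. ennreal (norm (weak_gradient \<phi> t) powr p) \<partial>cell_lebesgue)"
    unfolding W1p_norm_pow_def by (subst nn_integral_add[symmetric]) simp_all
  then show ?thesis
    using weak_gradient_cell_finite[OF \<phi>] Lp_loc_cell_finite[of \<phi> p] \<phi> by (simp add: W1p_per_def)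
qed

lemma lmeasurable_unit_cell: "(unit_cell :: (real^'d) set) \<in> lmeasurable"
  by (intro fmeasurableI) (simp_all add: unit_cell_measurable emeasure_unit_cell)

text \<open>An energy depends on a corrector only through its gradient, so density is asked for the
  gradients in L^p and not in the full Sobolev norm.\<close>

lemma ex_dense_gradients:
  assumes "p > 0" and "(W1p_per p :: (real^'d \<Rightarrow> real^'m) set) \<noteq> {}"
  obtains \<psi> :: "nat \<Rightarrow> real^'d \<Rightarrow> real^'m" where "range \<psi> \<subseteq> W1p_per p"
    and "\<And>\<phi> \<delta>. \<phi> \<in> W1p_per p \<Longrightarrow> \<delta> > 0 \<Longrightarrow>
      \<exists>j. Lp_dist_pow p cell_lebesgue (weak_gradient \<phi>) (weak_gradient (\<psi> j)) < ennreal \<delta>"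
  by (rule Lp_separable_family[where U = weak_gradient, OF lmeasurable_unit_cell assms
        weak_gradient_measurable weak_gradient_cell_finite]) (assumption | rule that)+


section \<open>Regular integrands\<close>

text \<open>The third condition passes to infima over correctors with unchanged constants, by the mere
  substitution of \<open>z + \<nabla>\<phi>\<close> for \<open>z\<close>. For \<open>f\<close> it follows from convexity and coercivity. It
  replaces convexity of the iterated integrands, which would require the linearity of
  \<open>weak_gradient\<close>.\<close>

definition regular_integrand ::
  "real \<Rightarrow> nat \<Rightarrow> ((nat \<Rightarrow> real^'d) \<Rightarrow> real^'d^'m \<Rightarrow> ennreal) \<Rightarrow> bool" where
  "regular_integrand p k h \<longleftrightarrow>
     (\<forall>z. (\<lambda>y. h y z) \<in> borel_measurable (cells_measure k)) \<and>
     (\<exists>B. \<forall>y\<in>cells k. h y 0 \<le> ennreal B) \<and>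
     (\<forall>\<epsilon>>0. \<exists>K\<ge>0. \<forall>y\<in>cells k. \<forall>z v.
        h y (z + v) \<le> ennreal (1 + \<epsilon>) * h y z + ennreal (\<epsilon> + K * norm v powr p))"

lemma regular_integrandD:
  fixes h :: "(nat \<Rightarrow> real^'d) \<Rightarrow> real^'d^'m \<Rightarrow> ennreal"
  assumes "regular_integrand p k h"
  shows regular_integrand_measurable: "(\<lambda>y. h y z) \<in> borel_measurable (cells_measure k)"
    and regular_integrand_bound: "\<exists>B. \<forall>y\<in>cells k. h y 0 \<le> ennreal B"
    and regular_integrand_modulus: "\<epsilon> > 0 \<Longrightarrow> \<exists>K\<ge>0. \<forall>y\<in>cells k. \<forall>z v.
        h y (z + v) \<le> ennreal (1 + \<epsilon>) * h y z + ennreal (\<epsilon> + K * norm v powr p)"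
  using assms unfolding regular_integrand_def by blast+

text \<open>This is the modulus with \<open>\<epsilon> = 1\<close>, started from z = 0.\<close>

lemma regular_integrand_growth:
  fixes h :: "(nat \<Rightarrow> real^'d) \<Rightarrow> real^'d^'m \<Rightarrow> ennreal"
  assumes "regular_integrand p k h"
  obtains B K where "B \<ge> 0" "K \<ge> 0"
    "\<And>y z. y \<in> cells k \<Longrightarrow> h y z \<le> ennreal (B + K * norm z powr p)"
proof -
  obtain B where B: "\<And>y. y \<in> cells k \<Longrightarrow> h y 0 \<le> ennreal B"
    using regular_integrand_bound[OF assms] by blast
  obtain K where K: "K \<ge> 0" "\<And>y z v. y \<in> cells k \<Longrightarrow>
      h y (z + v) \<le> ennreal (1 + 1) * h y z + ennreal (1 + K * norm v powr p)"
    using regular_integrand_modulus[OF assms zero_less_one] by blast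
  show ?thesis
  proof (rule that)
    \<comment> \<open>The bound at 0 is doubled by the factor 1 + \<open>\<epsilon>\<close>, and
      \<open>max\<close> covers a negative \<open>B\<close>, which \<open>ennreal\<close> reads as
      0.\<close>
    show "2 * max 0 B + 1 \<ge> 0" by simp
    show "K \<ge> 0" by fact
    fix y :: "nat \<Rightarrow> real^'d" and z :: "real^'d^'m" assume y: "y \<in> cells k"
    have "h y z \<le> ennreal (1 + 1) * h y 0 + ennreal (1 + K * norm z powr p)"
      using K(2)[OF y, of 0 z] by simp
    also have "\<dots> \<le> ennreal (1 + 1) * ennreal (max 0 B) + ennreal (1 + K * norm z powr p)"
      using B[OF y] by (intro add_right_mono mult_left_mono) (auto intro: order_trans ennreal_leI)
    also have "\<dots> = ennreal ((1 + 1) * max 0 B + (1 + K * norm z powr p))"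
      using K(1) by (subst ennreal_mult[symmetric]) (auto simp flip: ennreal_plus)
    also have "(1 + 1) * max 0 B + (1 + K * norm z powr p) = 2 * max 0 B + 1 + K * norm z powr p"
      by simp
    finally show "h y z \<le> ennreal (2 * max 0 B + 1 + K * norm z powr p)" .
  qed
qed

text \<open>The modulus is used in both directions, from z to \<open>s i\<close> and back. It is
  one-sided and multiplicative, so finiteness of the values is established before differences are
  formed.\<close>

lemma regular_integrand_tendsto:
  fixes h :: "(nat \<Rightarrow> real^'d) \<Rightarrow> real^'d^'m \<Rightarrow> ennreal"
  assumes h: "regular_integrand p k h" and "p > 0" and y: "y \<in> cells k" and s: "s \<longlonglongrightarrow> z"
  shows "(\<lambda>i. h y (s i)) \<longlonglongrightarrow> h y z"
proof -
  define r where "r z = enn2real (h y z)" for z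
  have hr: "h y z = ennreal (r z)" and r0: "r z \<ge> 0" for z
  proof -
    obtain B K where "h y z \<le> ennreal (B + K * norm z powr p)"
      using regular_integrand_growth[OF h] y by metis
    also have "\<dots> < top" by simp
    finally show "h y z = ennreal (r z)" by (simp add: r_def)
    show "r z \<ge> 0" by (simp add: r_def)
  qed
  have "(\<lambda>i. r (s i)) \<longlonglongrightarrow> r z"
    unfolding tendsto_iff
  proof (intro allI impI)
    fix e :: real assume "e > 0"
    \<comment> \<open>\<open>K\<close> depends on \<open>\<epsilon>\<close>, so
      \<open>\<epsilon>\<close> is fixed first, in terms of the limit value alone. The total error
      will be \<open>\<epsilon> * (2 * r z + 2) + 2 * d\<close>; this choice makes the first term at
      most e/2, and convergence makes the second smaller than e/2.\<close>
    define \<epsilon> where "\<epsilon> = min 1 (e / (4 * (r z + 1)))"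
    have \<epsilon>: "\<epsilon> > 0" "\<epsilon> \<le> 1" "\<epsilon> * (2 * r z + 2) \<le> e / 2"
    proof -
      show "\<epsilon> > 0" "\<epsilon> \<le> 1"
        using \<open>e > 0\<close> r0[of z] by (auto simp: \<epsilon>_def)
      have "\<epsilon> * (2 * r z + 2) \<le> e / (4 * (r z + 1)) * (2 * r z + 2)"
        using r0[of z] by (intro mult_right_mono) (auto simp: \<epsilon>_def)
      also have "\<dots> = e / 2"
        using r0[of z] by (simp add: field_simps)
      finally show "\<epsilon> * (2 * r z + 2) \<le> e / 2" .
    qed
    obtain K where K: "K \<ge> 0" "\<And>z v. h y (z + v) \<le> ennreal (1 + \<epsilon>) * h y z + ennreal (\<epsilon> + K * norm v powr p)"
      using regular_integrand_modulus[OF h \<epsilon>(1)] y by blast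
    have K': "r (z + v) \<le> (1 + \<epsilon>) * r z + (\<epsilon> + K * norm v powr p)" for z v
    proof -
      have "ennreal (r (z + v)) \<le> ennreal ((1 + \<epsilon>) * r z + (\<epsilon> + K * norm v powr p))"
        using K(2)[of z v] \<epsilon>(1) K(1) r0[of z]
        by (simp add: hr ennreal_mult[symmetric] ennreal_plus[symmetric] del: ennreal_plus)
      then show ?thesis
        using \<epsilon>(1) K(1) r0[of z] by (subst (asm) ennreal_le_iff) auto
    qed
    have "(\<lambda>i. 2 * K * norm (s i - z) powr p) \<longlonglongrightarrow> 2 * K * 0 powr p"
    proof (intro tendsto_intros tendsto_powr')
      show "(\<lambda>i. norm (s i - z)) \<longlonglongrightarrow> 0"
        using s by (simp add: LIM_zero_iff tendsto_norm_zero_iff)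
    qed (use \<open>p > 0\<close> in auto)
    then have "\<forall>\<^sub>F i in sequentially. 2 * K * norm (s i - z) powr p < e / 2"
      using \<open>e > 0\<close> by (intro order_tendstoD(2)) auto
    then show "\<forall>\<^sub>F i in sequentially. dist (r (s i)) (r z) < e"
    proof eventually_elim
      fix i
      define d where "d = K * norm (s i - z) powr p"
      have d: "d \<ge> 0" using K(1) by (simp add: d_def)
      assume "2 * K * norm (s i - z) powr p < e / 2"
      then have d2: "2 * d < e / 2" by (simp add: d_def)
      have 1: "r (s i) \<le> (1 + \<epsilon>) * r z + (\<epsilon> + d)"
        using K'[of z "s i - z"] by (simp add: d_def)
      have 2: "r z \<le> (1 + \<epsilon>) * r (s i) + (\<epsilon> + d)"
        using K'[of "s i" "z - s i"] by (simp add: d_def norm_minus_commute)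
      \<comment> \<open>The reverse estimate contains the moving value \<open>r (s i)\<close>; the
        first estimate replaces it by a bound in terms of \<open>r z\<close>.\<close>
      have "\<epsilon> * r (s i) \<le> \<epsilon> * (2 * r z + 1 + d)"
      proof (rule mult_left_mono)
        have "\<epsilon> * r z \<le> 1 * r z"
          using \<epsilon>(2) r0[of z] by (rule mult_right_mono)
        then show "r (s i) \<le> 2 * r z + 1 + d"
          using 1 \<epsilon>(2) by (simp add: algebra_simps)
      qed (use \<epsilon> in simp)
      also have "\<dots> = \<epsilon> * (2 * r z + 1) + \<epsilon> * d"
        by (simp add: algebra_simps)
      also have "\<epsilon> * d \<le> 1 * d"
        using \<epsilon>(2) d by (rule mult_right_mono)
      finally have "r z - r (s i) \<le> \<epsilon> * (2 * r z + 2) + 2 * d"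
        using 2 by (simp add: algebra_simps)
      moreover have "r (s i) - r z \<le> \<epsilon> * (2 * r z + 2) + 2 * d"
      proof -
        have "0 \<le> \<epsilon> * r z" using \<epsilon>(1) r0[of z] by simp
        then show ?thesis using 1 d \<epsilon>(1) by (simp add: algebra_simps)
      qed
      ultimately show "dist (r (s i)) (r z) < e"
        using \<epsilon>(3) d2 by (simp add: dist_real_def)
    qed
  qed
  then show ?thesis
    unfolding hr by (rule tendsto_ennrealI)
qed

text \<open>The usual argument for Caratheodory integrands: for simple \<open>w\<close> the
  composition is glued from finitely many sections, and continuity in z passes to limits.\<close>

lemma regular_integrand_measurable_comp:
  fixes h :: "(nat \<Rightarrow> real^'d) \<Rightarrow> real^'d^'m \<Rightarrow> ennreal"
  assumes h: "regular_integrand p k h" and "p > 0" and w: "w \<in> borel_measurable (cells_measure k)"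
  shows "(\<lambda>y. h y (w y)) \<in> borel_measurable (cells_measure k)"
proof -
  let ?M = "cells_measure k :: (nat \<Rightarrow> real^'d) measure"
  obtain s where s: "\<And>i. simple_function ?M (s i)" "\<And>y. y \<in> cells k \<Longrightarrow> (\<lambda>i. s i y) \<longlonglongrightarrow> w y"
    using borel_measurable_implies_sequence_metric[OF w, of 0] unfolding space_cells_measure by blast
  show ?thesis
  proof (rule borel_measurable_LIMSEQ_order)
    fix y :: "nat \<Rightarrow> real^'d" assume "y \<in> space ?M"
    then have y: "y \<in> cells k" by simp
    show "(\<lambda>i. h y (s i y)) \<longlonglongrightarrow> h y (w y)"
      by (rule regular_integrand_tendsto[OF h \<open>p > 0\<close> y s(2)[OF y]])
  next
    fix i
    have fin: "finite (s i ` space ?M)"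
      using s(1) by (rule simple_functionD)
    show "(\<lambda>y. h y (s i y)) \<in> borel_measurable ?M"
    proof (rule measurable_compose_countable'[where f = "\<lambda>z y. h y z"])
      show "s i \<in> measurable ?M (count_space (s i ` space ?M))"
        unfolding measurable_count_space_eq2[OF fin] using simple_functionD(2)[OF s(1)] by blast
      show "countable (s i ` space ?M)"
        using fin by (rule countable_finite)
    qed (rule regular_integrand_measurable[OF h])
  qed
qed


section \<open>The cell problem\<close>

definition cell_energy ::
  "nat \<Rightarrow> ((nat \<Rightarrow> real^'d) \<Rightarrow> real^'d^'m \<Rightarrow> ennreal) \<Rightarrow> (nat \<Rightarrow> real^'d) \<Rightarrow> real^'d^'m \<Rightarrow>
    (real^'d \<Rightarrow> real^'m) \<Rightarrow> ennreal" where
  "cell_energy k h y z \<phi> = (\<integral>\<^sup>+ t. h (y(Suc k := t)) (z + weak_gradient \<phi> t) \<partial>cell_lebesgue)"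

text \<open>The operator T of the overview.\<close>

definition cell_problem ::
  "real \<Rightarrow> nat \<Rightarrow> ((nat \<Rightarrow> real^'d) \<Rightarrow> real^'d^'m \<Rightarrow> ennreal) \<Rightarrow> (nat \<Rightarrow> real^'d) \<Rightarrow> real^'d^'m \<Rightarrow> ennreal" where
  "cell_problem p k h y z = (INF \<phi>\<in>W1p_per p. cell_energy k h y z \<phi>)"

text \<open>Two comparisons in one: \<open>\<phi> = \<psi>\<close> gives the modulus in z, and v = 0
  gives continuity in the gradient of the corrector. The claim is for every \<open>y\<close>, while
  sections of a function measurable for the completed product are measurable only for almost every
  \<open>y\<close>; hence the use of \<open>nn_integral_affine_le\<close>.\<close>

lemma cell_energy_le:
  fixes h :: "(nat \<Rightarrow> real^'d) \<Rightarrow> real^'d^'m \<Rightarrow> ennreal"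
  assumes \<epsilon>: "\<epsilon> > 0" and K: "K \<ge> 0" "\<And>y z v. y \<in> cells (Suc k) \<Longrightarrow>
      h y (z + v) \<le> ennreal (1 + \<epsilon>) * h y z + ennreal (\<epsilon> + K * norm v powr p)"
    and y: "y \<in> cells k" and \<phi>: "\<phi> \<in> W1p_per p" and \<psi>: "\<psi> \<in> W1p_per p"
  shows "cell_energy k h y (z + v) \<psi> \<le> ennreal (1 + \<epsilon>) * cell_energy k h y z \<phi> +
    (\<integral>\<^sup>+ t. ennreal (\<epsilon> + K * norm (v + (weak_gradient \<psi> t - weak_gradient \<phi> t)) powr p) \<partial>cell_lebesgue)"
proof -
  note [measurable] = weak_gradient_measurable[OF \<phi>] weak_gradient_measurable[OF \<psi>]
  let ?g = "\<lambda>t. \<epsilon> + K * norm (v + (weak_gradient \<psi> t - weak_gradient \<phi> t)) powr p"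
  have "cell_energy k h y (z + v) \<psi> \<le>
      (\<integral>\<^sup>+ t. ennreal (1 + \<epsilon>) * h (y(Suc k := t)) (z + weak_gradient \<phi> t) + ennreal (?g t) \<partial>cell_lebesgue)"
    unfolding cell_energy_def
  proof (rule nn_integral_mono)
    fix t :: "real^'d" assume "t \<in> space cell_lebesgue"
    then have "y(Suc k := t) \<in> cells (Suc k)"
      using cells_fun_upd[OF y] by simp
    moreover have "z + v + weak_gradient \<psi> t =
        (z + weak_gradient \<phi> t) + (v + (weak_gradient \<psi> t - weak_gradient \<phi> t))"
      by simp
    ultimately show "h (y(Suc k := t)) (z + v + weak_gradient \<psi> t) \<le>
        ennreal (1 + \<epsilon>) * h (y(Suc k := t)) (z + weak_gradient \<phi> t) + ennreal (?g t)"
      using K(2) by metis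
  qed
  also have "\<dots> \<le> ennreal (1 + \<epsilon>) * cell_energy k h y z \<phi> + (\<integral>\<^sup>+ t. ennreal (?g t) \<partial>cell_lebesgue)"
    unfolding cell_energy_def using \<epsilon> by (intro nn_integral_affine_le) auto
  finally show ?thesis .
qed

lemma cell_energy_finite:
  fixes h :: "(nat \<Rightarrow> real^'d) \<Rightarrow> real^'d^'m \<Rightarrow> ennreal"
  assumes h: "regular_integrand p (Suc k) h" and \<phi>: "\<phi> \<in> W1p_per p" and "p > 0"
  obtains B K where "B \<ge> 0" "K \<ge> 0"
    "\<And>y z. y \<in> cells k \<Longrightarrow> cell_energy k h y z \<phi> \<le> ennreal (B + K * norm z powr p)"
proof -
  note [measurable] = weak_gradient_measurable[OF \<phi>]
  obtain B K where BK: "B \<ge> 0" "K \<ge> 0"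
    "\<And>y z. y \<in> cells (Suc k) \<Longrightarrow> h y z \<le> ennreal (B + K * norm z powr p)"
    using regular_integrand_growth[OF h] by blast
  let ?I = "\<integral>\<^sup>+ t. ennreal (norm (weak_gradient \<phi> t) powr p) \<partial>cell_lebesgue"
  obtain I where I: "?I = ennreal I" "I \<ge> 0"
    using weak_gradient_cell_finite[OF \<phi>] by (cases ?I) auto
  show ?thesis
  proof (rule that)
    show "B + K * 2 powr p * I \<ge> 0" "K * 2 powr p \<ge> 0"
      using BK I(2) by auto
    fix y :: "nat \<Rightarrow> real^'d" and z assume y: "y \<in> cells k"
    have "cell_energy k h y z \<phi> \<le>
        (\<integral>\<^sup>+ t. ennreal (B + K * 2 powr p * norm z powr p) +
          ennreal (K * 2 powr p) * ennreal (norm (weak_gradient \<phi> t) powr p) \<partial>cell_lebesgue)"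
      unfolding cell_energy_def
    proof (rule nn_integral_mono)
      fix t :: "real^'d" assume "t \<in> space cell_lebesgue"
      then have "y(Suc k := t) \<in> cells (Suc k)"
        using cells_fun_upd[OF y] by simp
      then have "h (y(Suc k := t)) (z + weak_gradient \<phi> t) \<le> ennreal (B + K * norm (z + weak_gradient \<phi> t) powr p)"
        by (rule BK(3))
      also have "\<dots> \<le> ennreal (B + K * (2 powr p * (norm z powr p + norm (weak_gradient \<phi> t) powr p)))"
        using BK(2) norm_add_powr_le[OF \<open>p > 0\<close>] by (intro ennreal_leI add_left_mono mult_left_mono) auto
      also have "\<dots> = ennreal ((B + K * 2 powr p * norm z powr p) + K * 2 powr p * norm (weak_gradient \<phi> t) powr p)"
        by (simp add: algebra_simps)
      also have "\<dots> = ennreal (B + K * 2 powr p * norm z powr p) +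
          ennreal (K * 2 powr p) * ennreal (norm (weak_gradient \<phi> t) powr p)"
        using BK(1,2) by (simp add: ennreal_plus ennreal_mult)
      finally show "h (y(Suc k := t)) (z + weak_gradient \<phi> t) \<le> \<dots>" .
    qed
    also have "\<dots> = ennreal (B + K * 2 powr p * norm z powr p) + ennreal (K * 2 powr p) * ennreal I"
      by (subst nn_integral_add) (simp_all add: nn_integral_cmult I(1))
    also have "\<dots> = ennreal (B + K * 2 powr p * I + K * 2 powr p * norm z powr p)"
      using BK(1,2) I(2) by (simp add: ennreal_mult[symmetric] ennreal_plus[symmetric] algebra_simps del: ennreal_plus)
    finally show "cell_energy k h y z \<phi> \<le> ennreal (B + K * 2 powr p * I + K * 2 powr p * norm z powr p)" .
  qed
qed

text \<open>Written through \<open>restrict\<close> and the last coordinate, the integrand becomes a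
  function of tuples of length \<open>Suc k\<close>, and measurability of the inner integral is part
  of Fubini's theorem.\<close>

lemma measurable_cell_energy:
  fixes h :: "(nat \<Rightarrow> real^'d) \<Rightarrow> real^'d^'m \<Rightarrow> ennreal"
  assumes h: "regular_integrand p (Suc k) h" and \<phi>: "\<phi> \<in> W1p_per p" and "p > 0"
    and w: "w \<in> borel_measurable (cells_measure k)"
  shows "(\<lambda>y. cell_energy k h y (w y) \<phi>) \<in> borel_measurable (cells_measure k)"
proof -
  have "(\<lambda>y. w (restrict y {1..k}) + weak_gradient \<phi> (y (Suc k))) \<in> borel_measurable (cells_measure (Suc k))"
    by (intro borel_measurable_add measurable_compose[OF measurable_restrict_cells_Suc w]
        measurable_last_cells_measure weak_gradient_measurable[OF \<phi>])
  from nn_integral_cells_measure_Suc(2)[OF regular_integrand_measurable_comp[OF h \<open>p > 0\<close> this]]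
  have "(\<lambda>y. \<integral>\<^sup>+ t. h (y(Suc k := t)) (w (restrict (y(Suc k := t)) {1..k}) +
      weak_gradient \<phi> ((y(Suc k := t)) (Suc k))) \<partial>cell_lebesgue) \<in> borel_measurable (cells_measure k)" .
  then show ?thesis
    by (rule measurable_cong[THEN iffD1, rotated])
      (simp add: restrict_cells_fun_upd cell_energy_def del: restrict_fupd)
qed

text \<open>Measurability does not pass through an uncountable infimum. The sequence replacing it is
  the same for all \<open>y\<close> and \<open>z\<close>.\<close>

lemma cell_problem_eq_INF_dense:
  fixes h :: "(nat \<Rightarrow> real^'d) \<Rightarrow> real^'d^'m \<Rightarrow> ennreal"
  assumes h: "regular_integrand p (Suc k) h" and y: "y \<in> cells k" and "p > 0"
    and \<psi>: "range \<psi> \<subseteq> W1p_per p"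
    and dense: "\<And>\<phi> \<delta>. \<phi> \<in> W1p_per p \<Longrightarrow> \<delta> > 0 \<Longrightarrow>
      \<exists>j. Lp_dist_pow p cell_lebesgue (weak_gradient \<phi>) (weak_gradient (\<psi> j)) < ennreal \<delta>"
  shows "cell_problem p k h y z = (INF j. cell_energy k h y z (\<psi> j))"
proof (rule antisym)
  show "cell_problem p k h y z \<le> (INF j. cell_energy k h y z (\<psi> j))"
    unfolding cell_problem_def using \<psi> by (intro INF_mono) auto
  show "(INF j. cell_energy k h y z (\<psi> j)) \<le> cell_problem p k h y z"
    unfolding cell_problem_def
  proof (rule INF_greatest, rule ennreal_le_epsilon)
    fix \<phi> and e :: real assume \<phi>: "\<phi> \<in> W1p_per p" and "e > 0"
      and "cell_energy k h y z \<phi> < top"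
    then obtain a where a: "cell_energy k h y z \<phi> = ennreal a" "a \<ge> 0"
      by (cases "cell_energy k h y z \<phi>") auto
    \<comment> \<open>The errors are \<open>\<epsilon> * a\<close> from the factor,
      \<open>\<epsilon>\<close> from the constant, and at most another \<open>\<epsilon>\<close>
      from the distance of the gradients: together at most e.\<close>
    define \<epsilon> where "\<epsilon> = e / (a + 2)"
    have \<epsilon>: "\<epsilon> > 0" using \<open>e > 0\<close> a(2) by (simp add: \<epsilon>_def)
    obtain K where K: "K \<ge> 0" "\<And>y z v. y \<in> cells (Suc k) \<Longrightarrow>
        h y (z + v) \<le> ennreal (1 + \<epsilon>) * h y z + ennreal (\<epsilon> + K * norm v powr p)"
      using regular_integrand_modulus[OF h \<epsilon>] by blast
    \<comment> \<open>The distance is chosen after \<open>K\<close>, which may blow up as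
      \<open>\<epsilon>\<close> tends to 0.\<close>
    define \<delta> where "\<delta> = \<epsilon> / (K + 1)"
    have \<delta>: "\<delta> > 0" "K * \<delta> \<le> \<epsilon>"
      using \<epsilon> K(1) by (auto simp: \<delta>_def field_simps)
    obtain j where j: "Lp_dist_pow p cell_lebesgue (weak_gradient \<phi>) (weak_gradient (\<psi> j)) < ennreal \<delta>"
      using dense[OF \<phi> \<delta>(1)] by blast
    have \<psi>j: "\<psi> j \<in> W1p_per p" using \<psi> by auto
    note [measurable] = weak_gradient_measurable[OF \<phi>] weak_gradient_measurable[OF \<psi>j]
    have "(INF j. cell_energy k h y z (\<psi> j)) \<le> cell_energy k h y (z + 0) (\<psi> j)"
      unfolding add_0_right by (rule INF_lower) simp
    also have "\<dots> \<le> ennreal (1 + \<epsilon>) * cell_energy k h y z \<phi> +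
      (\<integral>\<^sup>+ t. ennreal (\<epsilon> + K * norm (0 + (weak_gradient (\<psi> j) t - weak_gradient \<phi> t)) powr p) \<partial>cell_lebesgue)"
      by (rule cell_energy_le[where h = h, OF \<epsilon> K y \<phi> \<psi>j])
    also have "(\<integral>\<^sup>+ t. ennreal (\<epsilon> + K * norm (0 + (weak_gradient (\<psi> j) t - weak_gradient \<phi> t)) powr p) \<partial>cell_lebesgue)
        = (\<integral>\<^sup>+ t. ennreal \<epsilon> + ennreal K * ennreal (norm (weak_gradient (\<psi> j) t - weak_gradient \<phi> t) powr p) \<partial>cell_lebesgue)"
      using \<epsilon> K(1) by (simp add: ennreal_plus ennreal_mult)
    also have "\<dots> = ennreal \<epsilon> + ennreal K * Lp_dist_pow p cell_lebesgue (weak_gradient \<phi>) (weak_gradient (\<psi> j))"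
      by (subst nn_integral_add) (simp_all add: nn_integral_cmult Lp_dist_pow_def norm_minus_commute)
    also have "ennreal (1 + \<epsilon>) * cell_energy k h y z \<phi> + \<dots> \<le>
        ennreal (1 + \<epsilon>) * ennreal a + (ennreal \<epsilon> + ennreal K * ennreal \<delta>)"
      using j by (intro add_mono mult_mono) (auto simp: a(1))
    also have "\<dots> = ennreal ((1 + \<epsilon>) * a + (\<epsilon> + K * \<delta>))"
      using \<epsilon> \<delta> K(1) a(2)
      by (simp add: ennreal_mult[symmetric] ennreal_plus[symmetric] del: ennreal_plus)
    also have "\<dots> \<le> ennreal (a + e)"
    proof (rule ennreal_leI)
      have "\<epsilon> * (a + 2) = e"
        using a(2) by (simp add: \<epsilon>_def)
      then show "(1 + \<epsilon>) * a + (\<epsilon> + K * \<delta>) \<le> a + e"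
        using \<delta>(2) by (simp add: algebra_simps)
    qed
    also have "\<dots> = cell_energy k h y z \<phi> + ennreal e"
      using a \<open>e > 0\<close> by (simp add: ennreal_plus)
    finally show "(INF j. cell_energy k h y z (\<psi> j)) \<le> cell_energy k h y z \<phi> + ennreal e" .
  qed
qed

text \<open>The same corrector serves z and z + v, so its gradient cancels from the difference of
  the arguments and each \<open>\<epsilon>\<close> keeps its constant \<open>K\<close>.\<close>

proposition regular_integrand_cell_problem:
  fixes h :: "(nat \<Rightarrow> real^'d) \<Rightarrow> real^'d^'m \<Rightarrow> ennreal"
  assumes h: "regular_integrand p (Suc k) h" and "p > 0"
    and ne: "(W1p_per p :: (real^'d \<Rightarrow> real^'m) set) \<noteq> {}"
  shows "regular_integrand p k (cell_problem p k h)"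
  unfolding regular_integrand_def
proof (intro conjI allI impI)
  fix z :: "real^'d^'m"
  obtain \<psi> :: "nat \<Rightarrow> real^'d \<Rightarrow> real^'m" where \<psi>: "range \<psi> \<subseteq> W1p_per p"
    "\<And>\<phi> \<delta>. \<phi> \<in> W1p_per p \<Longrightarrow> \<delta> > 0 \<Longrightarrow>
      \<exists>j. Lp_dist_pow p cell_lebesgue (weak_gradient \<phi>) (weak_gradient (\<psi> j)) < ennreal \<delta>"
    using ex_dense_gradients[OF \<open>p > 0\<close> ne] by blast
  have "(\<lambda>y. cell_energy k h y z (\<psi> j)) \<in> borel_measurable (cells_measure k)" for j
    using \<psi>(1) by (intro measurable_cell_energy[OF h _ \<open>p > 0\<close>, of _ "\<lambda>_. z"]) auto
  then have "(\<lambda>y. INF j. cell_energy k h y z (\<psi> j)) \<in> borel_measurable (cells_measure k)"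
    by measurable
  moreover have "(\<lambda>y. INF j. cell_energy k h y z (\<psi> j)) \<in> borel_measurable (cells_measure k) \<longleftrightarrow>
      (\<lambda>y. cell_problem p k h y z) \<in> borel_measurable (cells_measure k)"
  proof (rule measurable_cong)
    fix y :: "nat \<Rightarrow> real^'d" assume "y \<in> space (cells_measure k)"
    then show "(INF j. cell_energy k h y z (\<psi> j)) = cell_problem p k h y z"
      using cell_problem_eq_INF_dense[OF h _ \<open>p > 0\<close> \<psi>, of y z] by simp
  qed
  ultimately show "(\<lambda>y. cell_problem p k h y z) \<in> borel_measurable (cells_measure k)"
    by simp
next
  \<comment> \<open>Any fixed corrector bounds the infimum uniformly in \<open>y\<close>.\<close>
  obtain \<phi> :: "real^'d \<Rightarrow> real^'m" where \<phi>: "\<phi> \<in> W1p_per p" using ne by blast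
  obtain B K where "B \<ge> 0" "K \<ge> 0"
    and "\<And>y z. y \<in> cells k \<Longrightarrow> cell_energy k h y z \<phi> \<le> ennreal (B + K * norm z powr p)"
    by (rule cell_energy_finite[OF h \<phi> \<open>p > 0\<close>]) (rule that)
  then have "\<forall>y\<in>cells k. cell_problem p k h y 0 \<le> ennreal (B + K * norm (0 :: real^'d^'m) powr p)"
    unfolding cell_problem_def using \<phi> by (blast intro: INF_lower2)
  then show "\<exists>B. \<forall>y\<in>cells k. cell_problem p k h y 0 \<le> ennreal B"
    by blast
next
  fix \<epsilon> :: real assume \<epsilon>: "\<epsilon> > 0"
  obtain K where K: "K \<ge> 0" "\<And>y z v. y \<in> cells (Suc k) \<Longrightarrow>
      h y (z + v) \<le> ennreal (1 + \<epsilon>) * h y z + ennreal (\<epsilon> + K * norm v powr p)"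
    using regular_integrand_modulus[OF h \<epsilon>] by blast
  have "cell_problem p k h y (z + v) \<le> ennreal (1 + \<epsilon>) * cell_problem p k h y z + ennreal (\<epsilon> + K * norm v powr p)"
    if y: "y \<in> cells k" for y z v
  proof -
    \<comment> \<open>Solved for the energy, the inequality has a left-hand side independent of
      \<open>\<phi>\<close>, so the infimum over \<open>\<phi>\<close> can be taken on the
      right.\<close>
    have "(cell_problem p k h y (z + v) - ennreal (\<epsilon> + K * norm v powr p)) / ennreal (1 + \<epsilon>) \<le> cell_energy k h y z \<phi>"
      if \<phi>: "\<phi> \<in> W1p_per p" for \<phi>
    proof -
      have "cell_problem p k h y (z + v) \<le> cell_energy k h y (z + v) \<phi>"
        unfolding cell_problem_def using \<phi> by (rule INF_lower)
      also have "\<dots> \<le> ennreal (1 + \<epsilon>) * cell_energy k h y z \<phi> + ennreal (\<epsilon> + K * norm v powr p)"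
        using cell_energy_le[where h = h and v = v, OF \<epsilon> K y \<phi> \<phi>] by simp
      finally show ?thesis
        by (rule ennreal_le_affine_iff[THEN iffD1, rotated]) (use \<epsilon> in simp)
    qed
    then have "(cell_problem p k h y (z + v) - ennreal (\<epsilon> + K * norm v powr p)) / ennreal (1 + \<epsilon>) \<le> cell_problem p k h y z"
      unfolding cell_problem_def[of p k h y z] by (rule INF_greatest)
    then show ?thesis
      by (rule ennreal_le_affine_iff[THEN iffD2, rotated]) (use \<epsilon> in simp)
  qed
  with K(1) show "\<exists>K\<ge>0. \<forall>y\<in>cells k. \<forall>z v. cell_problem p k h y (z + v) \<le>
      ennreal (1 + \<epsilon>) * cell_problem p k h y z + ennreal (\<epsilon> + K * norm v powr p)"
    by blast
qed


section \<open>Regularity of the original integrand\<close>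

lemma regular_integrand_of_convex:
  fixes g :: "(nat \<Rightarrow> real^'d) \<Rightarrow> real^'d^'m \<Rightarrow> real"
  assumes "p > 0" and "c1 > 0" and "c2 > 0"
    and meas: "\<And>z. (\<lambda>y. g y z) \<in> borel_measurable (cells_measure n)"
    and convex: "\<And>y. y \<in> cells n \<Longrightarrow> convex_on UNIV (g y)"
    and lower: "\<And>y z. y \<in> cells n \<Longrightarrow> c1 * norm z powr p \<le> g y z"
    and upper: "\<And>y z. y \<in> cells n \<Longrightarrow> g y z \<le> c2 * (1 + norm z powr p)"
  shows "regular_integrand p n (\<lambda>y z. ennreal (g y z))"
  unfolding regular_integrand_def
proof (intro conjI allI impI)
  show "(\<lambda>y. ennreal (g y z)) \<in> borel_measurable (cells_measure n)" for z
    using meas by measurable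
  show "\<exists>B. \<forall>y\<in>cells n. ennreal (g y 0) \<le> ennreal B"
    using upper[where z = 0] \<open>p > 0\<close> by (intro exI[of _ c2] ballI ennreal_leI) simp
  fix \<epsilon> :: real assume \<epsilon>: "\<epsilon> > 0"
  \<comment> \<open>With l at most 1 the point z + v is a convex combination.
    \<open>l * c2 \<le> \<epsilon>\<close> absorbs the constant of the upper growth bound; the last
    bound lets coercivity turn the term in \<open>norm z powr p\<close> into
    \<open>\<epsilon> * g y z\<close>.\<close>
  define l where "l = min (1/2) (min (\<epsilon> / c2) (\<epsilon> * c1 / (c2 * 2 powr p)))"
  have l: "l > 0" "l \<le> 1" "l * c2 \<le> \<epsilon>" "l * c2 * 2 powr p \<le> \<epsilon> * c1"
  proof -
    show "l > 0" "l \<le> 1"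
      using \<epsilon> assms(2,3) by (auto simp: l_def)
    have "l \<le> \<epsilon> / c2" "l \<le> \<epsilon> * c1 / (c2 * 2 powr p)"
      by (auto simp: l_def)
    then show "l * c2 \<le> \<epsilon>" "l * c2 * 2 powr p \<le> \<epsilon> * c1"
      using assms(3) by (simp_all add: field_simps)
  qed
  \<comment> \<open>The factor \<open>(1 / l) powr p\<close> comes from the dilated increment v /
    l.\<close>
  define K where "K = l * c2 * 2 powr p * (1 / l) powr p"
  have "K \<ge> 0"
    using l(1) assms(3) by (simp add: K_def)
  have "ennreal (g y (z + v)) \<le> ennreal (1 + \<epsilon>) * ennreal (g y z) + ennreal (\<epsilon> + K * norm v powr p)"
    if y: "y \<in> cells n" for y z v
  proof -
    have g0: "0 \<le> g y z" for z
      using lower[OF y, of z] \<open>c1 > 0\<close> by (meson mult_nonneg_nonneg less_imp_le order_trans powr_ge_zero)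
    have "z + v = (1 - l) *\<^sub>R z + l *\<^sub>R (z + (1 / l) *\<^sub>R v)"
      using l(1) by (simp add: algebra_simps)
    then have "g y (z + v) \<le> (1 - l) * g y z + l * g y (z + (1 / l) *\<^sub>R v)"
      using convex_onD[OF convex[OF y], of l z "z + (1 / l) *\<^sub>R v"] l(1,2) by simp
    also have "\<dots> \<le> 1 * g y z + l * (c2 * (1 + 2 powr p * (norm z powr p + norm ((1 / l) *\<^sub>R v) powr p)))"
    proof (intro add_mono mult_right_mono mult_left_mono)
      have "g y (z + (1 / l) *\<^sub>R v) \<le> c2 * (1 + norm (z + (1 / l) *\<^sub>R v) powr p)"
        by (rule upper[OF y])
      also have "\<dots> \<le> c2 * (1 + 2 powr p * (norm z powr p + norm ((1 / l) *\<^sub>R v) powr p))"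
        using \<open>c2 > 0\<close> by (intro mult_left_mono add_left_mono norm_add_powr_le \<open>p > 0\<close>) simp
      finally show "g y (z + (1 / l) *\<^sub>R v) \<le> \<dots>" .
    qed (use l g0 in auto)
    also have "norm ((1 / l) *\<^sub>R v) powr p = (1 / l) powr p * norm v powr p"
      using l(1) powr_mult[of "1 / l" "norm v" p] by simp
    also have "1 * g y z + l * (c2 * (1 + 2 powr p * (norm z powr p + (1 / l) powr p * norm v powr p)))
        = g y z + l * c2 * 2 powr p * norm z powr p + l * c2 + K * norm v powr p"
      by (simp add: K_def algebra_simps)
    also have "l * c2 * 2 powr p * norm z powr p \<le> \<epsilon> * c1 * norm z powr p"
      by (intro mult_right_mono l) simp
    also have "\<epsilon> * c1 * norm z powr p \<le> \<epsilon> * g y z"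
      using lower[OF y, of z] \<epsilon> by (simp add: mult.assoc)
    finally have "g y (z + v) \<le> (1 + \<epsilon>) * g y z + (\<epsilon> + K * norm v powr p)"
      using l(3) by (simp add: algebra_simps)
    then have "ennreal (g y (z + v)) \<le> ennreal ((1 + \<epsilon>) * g y z + (\<epsilon> + K * norm v powr p))"
      by (rule ennreal_leI)
    also have "\<dots> = ennreal ((1 + \<epsilon>) * g y z) + ennreal (\<epsilon> + K * norm v powr p)"
      using \<epsilon> \<open>K \<ge> 0\<close> g0[of z] by (intro ennreal_plus) auto
    also have "ennreal ((1 + \<epsilon>) * g y z) = ennreal (1 + \<epsilon>) * ennreal (g y z)"
      using \<epsilon> g0[of z] by (intro ennreal_mult) auto
    finally show ?thesis .
  qed
  with \<open>K \<ge> 0\<close> show "\<exists>K\<ge>0. \<forall>y\<in>cells n. \<forall>z v. ennreal (g y (z + v)) \<le>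
      ennreal (1 + \<epsilon>) * ennreal (g y z) + ennreal (\<epsilon> + K * norm v powr p)"
    by blast
qed

section \<open>One step of the comparison, in both directions\<close>

text \<open>For almost every \<open>y\<close> the section of \<open>D\<close> is the weak gradient
  of \<open>\<phi> y\<close>, so the inner integral is the energy of an admissible
  competitor.\<close>

lemma nn_integral_cell_problem_le:
  fixes h :: "(nat \<Rightarrow> real^'d) \<Rightarrow> real^'d^'m \<Rightarrow> ennreal"
  assumes h: "regular_integrand p (Suc k) h" and "p > 0"
    and w: "w \<in> borel_measurable (cells_measure k)"
    and \<phi>: "\<phi> \<in> Bochner_Lp_W1p p k" and D: "is_gradient_in (Suc k) \<phi> D"
  shows "(\<integral>\<^sup>+ y. cell_problem p k h y (w y) \<partial>cells_measure k)
    \<le> (\<integral>\<^sup>+ y. h y (w (restrict y {1..k}) + D y) \<partial>cells_measure (Suc k))"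
proof -
  have mD: "D \<in> borel_measurable (cells_measure (Suc k))"
    and eq: "AE y in cells_measure k. AE t in cell_lebesgue. D (y(Suc k := t)) = weak_gradient (\<phi> y) t"
    using D unfolding is_gradient_in_def diff_Suc_1 by simp_all
  have \<phi>W: "\<phi> y \<in> W1p_per p" if "y \<in> cells k" for y
    using \<phi> that by (simp add: Bochner_Lp_W1p_def)
  have "(\<lambda>y. w (restrict y {1..k}) + D y) \<in> borel_measurable (cells_measure (Suc k))"
    by (intro borel_measurable_add measurable_compose[OF measurable_restrict_cells_Suc w] mD)
  note m = regular_integrand_measurable_comp[OF h \<open>p > 0\<close> this]
  have "AE y in cells_measure k. cell_problem p k h y (w y) \<le>
      (\<integral>\<^sup>+ t. h (y(Suc k := t)) (w (restrict (y(Suc k := t)) {1..k}) + D (y(Suc k := t))) \<partial>cell_lebesgue)"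
    using eq AE_space
  proof eventually_elim
    fix y :: "nat \<Rightarrow> real^'d"
    assume y: "y \<in> space (cells_measure k)"
      and eq: "AE t in cell_lebesgue. D (y(Suc k := t)) = weak_gradient (\<phi> y) t"
    have r: "restrict (y(Suc k := t)) {1..k} = y" for t
      using y by (intro restrict_cells_fun_upd) simp
    have "cell_problem p k h y (w y) \<le> cell_energy k h y (w y) (\<phi> y)"
      unfolding cell_problem_def using y by (intro INF_lower \<phi>W) simp
    also have "\<dots> = (\<integral>\<^sup>+ t. h (y(Suc k := t)) (w (restrict (y(Suc k := t)) {1..k}) + D (y(Suc k := t))) \<partial>cell_lebesgue)"
      unfolding cell_energy_def r
    proof (rule nn_integral_cong_AE)
      show "AE t in cell_lebesgue. h (y(Suc k := t)) (w y + weak_gradient (\<phi> y) t) =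
          h (y(Suc k := t)) (w y + D (y(Suc k := t)))"
        using eq by eventually_elim simp
    qed
    finally show "cell_problem p k h y (w y) \<le> \<dots>" .
  qed
  then show ?thesis
    unfolding nn_integral_cells_measure_Suc(1)[OF m] by (rule nn_integral_mono_AE)
qed

text \<open>An almost optimal corrector depending measurably on \<open>y\<close>: the best among the first \<open>J + 1\<close>
  members of a dense sequence. As it takes finitely many values, its strong measurability and
  integrability need no Poincare inequality.\<close>

lemma ex_almost_optimal_corrector:
  fixes h :: "(nat \<Rightarrow> real^'d) \<Rightarrow> real^'d^'m \<Rightarrow> ennreal"
  assumes h: "regular_integrand p (Suc k) h" and "p > 0"
    and ne: "(W1p_per p :: (real^'d \<Rightarrow> real^'m) set) \<noteq> {}"
    and w: "w \<in> borel_measurable (cells_measure k)"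
    and fin: "(\<integral>\<^sup>+ y. ennreal (norm (w y) powr p) \<partial>cells_measure k) < \<infinity>" and "\<epsilon> > 0"
  obtains \<phi> D where "\<phi> \<in> Bochner_Lp_W1p p k" and "is_gradient_in (Suc k) \<phi> D"
    and "(\<integral>\<^sup>+ y. ennreal (norm (w (restrict y {1..k}) + D y) powr p) \<partial>cells_measure (Suc k)) < \<infinity>"
    and "(\<integral>\<^sup>+ y. h y (w (restrict y {1..k}) + D y) \<partial>cells_measure (Suc k))
      \<le> (\<integral>\<^sup>+ y. cell_problem p k h y (w y) \<partial>cells_measure k) + ennreal \<epsilon>"
proof -
  let ?M = "cells_measure k :: (nat \<Rightarrow> real^'d) measure"
  obtain \<psi> :: "nat \<Rightarrow> real^'d \<Rightarrow> real^'m" where \<psi>: "range \<psi> \<subseteq> W1p_per p"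
    "\<And>\<phi> \<delta>. \<phi> \<in> W1p_per p \<Longrightarrow> \<delta> > 0 \<Longrightarrow>
      \<exists>j. Lp_dist_pow p cell_lebesgue (weak_gradient \<phi>) (weak_gradient (\<psi> j)) < ennreal \<delta>"
    using ex_dense_gradients[OF \<open>p > 0\<close> ne] by blast
  have \<psi>W: "\<psi> j \<in> W1p_per p" for j using \<psi>(1) by blast
  define G where "G j y = cell_energy k h y (w y) (\<psi> j)" for j y
  have mG [measurable]: "G j \<in> borel_measurable ?M" for j
    unfolding G_def by (rule measurable_cell_energy[OF h \<psi>W \<open>p > 0\<close> w])
  \<comment> \<open>Taking the least minimizing index makes the selection unique and hence
    measurable in \<open>y\<close>.\<close>
  define N where "N J y = (LEAST j. j \<le> J \<and> (\<forall>i\<le>J. G j y \<le> G i y))" for J y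
  have N: "N J y \<le> J \<and> (\<forall>i\<le>J. G (N J y) y \<le> G i y)" for J y
    unfolding N_def
  proof (rule LeastI_ex)
    have "Min ((\<lambda>j. G j y) ` {..J}) \<in> (\<lambda>j. G j y) ` {..J}"
      by (intro Min_in) auto
    then obtain j where j: "Min ((\<lambda>j. G j y) ` {..J}) = G j y" and "j \<in> {..J}"
      by (rule imageE)
    then show "\<exists>j. j \<le> J \<and> (\<forall>i\<le>J. G j y \<le> G i y)"
      by (intro exI[of _ j]) (auto simp flip: j)
  qed
  have mN: "N J \<in> measurable ?M (count_space UNIV)" for J
    unfolding N_def
  proof (rule measurable_Least)
    fix j
    have le: "Measurable.pred ?M (\<lambda>y. G j y \<le> G i y)" for i
      unfolding pred_def by (rule borel_measurable_le) (rule mG)+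
    have "Measurable.pred ?M (\<lambda>y. \<forall>i\<in>{..J}. G j y \<le> G i y)"
      by (rule pred_intros_finite(3)) (rule finite_atMost, rule le)
    then show "Measurable.pred ?M (\<lambda>y. j \<le> J \<and> (\<forall>i\<le>J. G j y \<le> G i y))"
      unfolding Ball_def atMost_iff by (rule pred_intros_conj1')
  qed
  have mGN: "(\<lambda>y. G (N J y) y) \<in> borel_measurable ?M" for J
    by (rule measurable_compose_countable[OF mG mN])
  have INF_eq: "(INF J. G (N J y) y) = cell_problem p k h y (w y)" if "y \<in> cells k" for y
  proof -
    have "(INF J. G (N J y) y) = (INF j. G j y)"
    proof (rule antisym)
      show "(INF J. G (N J y) y) \<le> (INF j. G j y)"
        using N by (intro INF_mono) blast
      show "(INF j. G j y) \<le> (INF J. G (N J y) y)"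
        by (intro INF_greatest INF_lower) simp
    qed
    also have "\<dots> = cell_problem p k h y (w y)"
      unfolding G_def using cell_problem_eq_INF_dense[OF h that \<open>p > 0\<close> \<psi>] by simp
    finally show ?thesis .
  qed
  \<comment> \<open>The starting member of the decreasing sequence: only the index 0 is available,
    and its energy has growth p in \<open>w\<close>, which lies in L^p.\<close>
  have fin0: "(\<integral>\<^sup>+ y. G (N 0 y) y \<partial>?M) < \<infinity>"
  proof -
    obtain B K where BK: "B \<ge> 0" "K \<ge> 0"
      "\<And>y z. y \<in> cells k \<Longrightarrow> cell_energy k h y z (\<psi> 0) \<le> ennreal (B + K * norm z powr p)"
      by (rule cell_energy_finite[OF h \<psi>W[of 0] \<open>p > 0\<close>]) (rule that)
    have "(\<integral>\<^sup>+ y. G (N 0 y) y \<partial>?M) \<le> (\<integral>\<^sup>+ y. ennreal B + ennreal K * ennreal (norm (w y) powr p) \<partial>?M)"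
    proof (rule nn_integral_mono)
      fix y assume "y \<in> space ?M"
      then have "G 0 y \<le> ennreal (B + K * norm (w y) powr p)"
        unfolding G_def by (intro BK) simp
      also have "\<dots> = ennreal B + ennreal K * ennreal (norm (w y) powr p)"
        using BK(1,2) by (simp add: ennreal_plus ennreal_mult)
      finally show "G (N 0 y) y \<le> \<dots>"
        using N[of 0 y] by simp
    qed
    also have "\<dots> = ennreal B + ennreal K * (\<integral>\<^sup>+ y. ennreal (norm (w y) powr p) \<partial>?M)"
      using w by (subst nn_integral_add) (simp_all add: nn_integral_cmult)
    also have "\<dots> < \<infinity>"
      using fin by (simp add: ennreal_mult_less_top)
    finally show ?thesis .
  qed
  have INF_int: "(\<integral>\<^sup>+ y. (INF J. G (N J y) y) \<partial>?M) = (INF J. \<integral>\<^sup>+ y. G (N J y) y \<partial>?M)"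
  proof (rule nn_integral_monotone_convergence_INF_AE'[where f = "\<lambda>J y. G (N J y) y", OF _ mGN fin0])
    have "G (N (Suc J) y) y \<le> G (N J y) y" for J y
      using N[of J y] N[of "Suc J" y] by (meson le_SucI)
    then show "AE y in ?M. G (N (Suc J) y) y \<le> G (N J y) y" for J
      by simp
  qed
  let ?I = "\<integral>\<^sup>+ y. cell_problem p k h y (w y) \<partial>?M"
  have I: "?I = (INF J. \<integral>\<^sup>+ y. G (N J y) y \<partial>?M)"
    unfolding INF_int[symmetric] using INF_eq by (intro nn_integral_cong) simp
  have "?I \<le> (\<integral>\<^sup>+ y. G (N 0 y) y \<partial>?M)"
    unfolding I by (rule INF_lower) simp
  then have "?I < top"
    using fin0 by (auto intro: le_less_trans)
  \<comment> \<open>Finiteness of the infimum makes this strict, so some \<open>J\<close> falls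
    below the right-hand side.\<close>
  then have "?I < ?I + ennreal \<epsilon>"
    using \<open>\<epsilon> > 0\<close> by (cases ?I) (auto simp: ennreal_less_iff simp flip: ennreal_plus)
  then obtain J where J: "(\<integral>\<^sup>+ y. G (N J y) y \<partial>?M) < ?I + ennreal \<epsilon>"
    by (subst (asm) I) (auto simp: INF_less_iff)
  define \<phi> where "\<phi> y = \<psi> (N J y)" for y
  \<comment> \<open>Since \<open>N J\<close> takes finitely many values, \<open>D\<close> is glued
    from finitely many fixed weak gradients, which makes it jointly measurable.\<close>
  define D where "D y = weak_gradient (\<phi> (restrict y {1..k})) (y (Suc k))" for y :: "nat \<Rightarrow> real^'d"
  have NJ: "N J y \<le> J" for y using N by blast
  have mD: "D \<in> borel_measurable (cells_measure (Suc k))"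
    unfolding D_def \<phi>_def
  proof (rule measurable_compose_countable[where g = "\<lambda>y. N J (restrict y {1..k})"])
    show "(\<lambda>y. weak_gradient (\<psi> j) (y (Suc k))) \<in> borel_measurable (cells_measure (Suc k))" for j
      by (rule measurable_last_cells_measure[OF weak_gradient_measurable[OF \<psi>W]])
    show "(\<lambda>y. N J (restrict y {1..k})) \<in> measurable (cells_measure (Suc k)) (count_space UNIV)"
      by (rule measurable_compose[OF measurable_restrict_cells_Suc mN])
  qed
  have mw: "(\<lambda>y. w (restrict y {1..k})) \<in> borel_measurable (cells_measure (Suc k))"
    by (rule measurable_compose[OF measurable_restrict_cells_Suc w])
  have r: "restrict (y(Suc k := t)) {1..k} = y" if "y \<in> cells k" for y :: "nat \<Rightarrow> real^'d" and t
    using that by (rule restrict_cells_fun_upd)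
  have D_upd: "D (y(Suc k := t)) = weak_gradient (\<phi> y) t" if "y \<in> cells k" for y t
    unfolding D_def r[OF that] by simp
  show thesis
  proof (rule that)
    have sf: "simple_function ?M \<phi>"
      unfolding \<phi>_def
    proof (rule simple_function_compose1)
      have "N J ` space ?M \<subseteq> {..J}" using NJ by auto
      then show "simple_function ?M (N J)"
        unfolding simple_function_def
        by (intro conjI ballI measurable_sets[OF mN] finite_subset[OF _ finite_atMost]) auto
    qed
    \<comment> \<open>A simple map is its own approximating sequence, constant in the index.\<close>
    have dist0: "W1p_dist_pow p (\<phi> y) (\<phi> y) = 0" for y
      by (simp add: W1p_dist_pow_def)
    have "(\<integral>\<^sup>+ y. W1p_norm_pow p (\<phi> y) \<partial>?M) \<le> (\<integral>\<^sup>+ y. (\<Sum>j\<le>J. W1p_norm_pow p (\<psi> j)) \<partial>?M)"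
      unfolding \<phi>_def using NJ by (intro nn_integral_mono member_le_sum) auto
    also have "\<dots> < \<infinity>"
      using W1p_norm_pow_finite[OF \<psi>W] by simp
    finally have "(\<integral>\<^sup>+ y. W1p_norm_pow p (\<phi> y) \<partial>?M) < \<infinity>" .
    moreover have "\<phi> y \<in> W1p_per p" for y
      by (simp add: \<phi>_def \<psi>W)
    ultimately show "\<phi> \<in> Bochner_Lp_W1p p k"
      unfolding Bochner_Lp_W1p_def using sf dist0
      by (intro CollectI conjI exI[of _ "\<lambda>_. \<phi>"]) auto
    show "is_gradient_in (Suc k) \<phi> D"
      unfolding is_gradient_in_def using mD D_upd by (auto intro!: AE_I2)
    have m: "(\<lambda>y. w (restrict y {1..k}) + D y) \<in> borel_measurable (cells_measure (Suc k))"
      by (intro borel_measurable_add mw mD)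
    have "(\<integral>\<^sup>+ y. h y (w (restrict y {1..k}) + D y) \<partial>cells_measure (Suc k)) = (\<integral>\<^sup>+ y. G (N J y) y \<partial>?M)"
      unfolding nn_integral_cells_measure_Suc(1)[OF regular_integrand_measurable_comp[OF h \<open>p > 0\<close> m]]
      by (intro nn_integral_cong) (simp only: space_cells_measure r D_upd G_def \<phi>_def cell_energy_def)
    then show "(\<integral>\<^sup>+ y. h y (w (restrict y {1..k}) + D y) \<partial>cells_measure (Suc k)) \<le> ?I + ennreal \<epsilon>"
      using J by simp
    have mn: "(\<lambda>y. ennreal (norm (w (restrict y {1..k}) + D y) powr p)) \<in> borel_measurable (cells_measure (Suc k))"
      using m by measurable
    \<comment> \<open>The sum over all candidates bounds the gradient norm of the selected one
      uniformly in \<open>y\<close>.\<close>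
    let ?S = "\<Sum>j\<le>J. \<integral>\<^sup>+ t. ennreal (norm (weak_gradient (\<psi> j) t) powr p) \<partial>cell_lebesgue"
    have "(\<integral>\<^sup>+ y. ennreal (norm (w (restrict y {1..k}) + D y) powr p) \<partial>cells_measure (Suc k)) =
        (\<integral>\<^sup>+ y. (\<integral>\<^sup>+ t. ennreal (norm (w y + weak_gradient (\<phi> y) t) powr p) \<partial>cell_lebesgue) \<partial>?M)"
      unfolding nn_integral_cells_measure_Suc(1)[OF mn]
      by (intro nn_integral_cong) (simp only: space_cells_measure r D_upd)
    also have "\<dots> \<le> (\<integral>\<^sup>+ y. ennreal (2 powr p) * (ennreal (norm (w y) powr p) + ?S) \<partial>?M)"
    proof (rule nn_integral_mono)
      fix y
      note [measurable] = weak_gradient_measurable[OF \<psi>W]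
      have "(\<integral>\<^sup>+ t. ennreal (norm (w y + weak_gradient (\<phi> y) t) powr p) \<partial>cell_lebesgue) \<le>
          (\<integral>\<^sup>+ t. ennreal (2 powr p) * (ennreal (norm (w y) powr p) +
            ennreal (norm (weak_gradient (\<psi> (N J y)) t) powr p)) \<partial>cell_lebesgue)"
        using norm_add_powr_le[OF \<open>p > 0\<close>] unfolding \<phi>_def
        by (intro nn_integral_mono) (simp add: ennreal_leI flip: ennreal_mult ennreal_plus)
      also have "\<dots> = ennreal (2 powr p) * (ennreal (norm (w y) powr p) +
          (\<integral>\<^sup>+ t. ennreal (norm (weak_gradient (\<psi> (N J y)) t) powr p) \<partial>cell_lebesgue))"
        by (simp add: nn_integral_cmult nn_integral_add)
      also have "\<dots> \<le> ennreal (2 powr p) * (ennreal (norm (w y) powr p) + ?S)"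
        using NJ by (intro mult_left_mono add_left_mono member_le_sum) auto
      finally show "(\<integral>\<^sup>+ t. ennreal (norm (w y + weak_gradient (\<phi> y) t) powr p) \<partial>cell_lebesgue) \<le>
        ennreal (2 powr p) * (ennreal (norm (w y) powr p) + ?S)" .
    qed
    also have "\<dots> = ennreal (2 powr p) * ((\<integral>\<^sup>+ y. ennreal (norm (w y) powr p) \<partial>?M) + ?S)"
      using w by (simp add: nn_integral_cmult nn_integral_add)
    also have "\<dots> < \<infinity>"
      using fin weak_gradient_cell_finite[OF \<psi>W] by (simp add: ennreal_mult_less_top)
    finally show "(\<integral>\<^sup>+ y. ennreal (norm (w (restrict y {1..k}) + D y) powr p) \<partial>cells_measure (Suc k)) < \<infinity>" .
  qed
qed


section \<open>The iterated integrands\<close>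

text \<open>The index is shifted: \<open>f_hom_iter p n f (Suc k)\<close> is the integrand in the
  first \<open>k\<close> cell variables and so belongs to \<open>cells_measure k\<close>.\<close>

lemma f_hom_iter_Suc:
  "k < n \<Longrightarrow> f_hom_iter p n f (Suc k) x y z = cell_problem p k (f_hom_iter p n f (Suc (Suc k)) x) y z"
  by (subst f_hom_iter.simps) (simp add: cell_problem_def cell_energy_def)

lemma f_hom_iter_last: "f_hom_iter p n f (Suc n) x = (\<lambda>y z. ennreal (f x y z))"
  by (intro ext, subst f_hom_iter.simps) simp

lemma regular_integrand_f_hom_iter:
  fixes f :: "real^'d \<Rightarrow> (nat \<Rightarrow> real^'d) \<Rightarrow> real^'d^'m \<Rightarrow> real"
  assumes "p > 0" and ne: "(W1p_per p :: (real^'d \<Rightarrow> real^'m) set) \<noteq> {}"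
    and f: "regular_integrand p n (\<lambda>y z. ennreal (f x y z))" and "k \<le> n"
  shows "regular_integrand p k (f_hom_iter p n f (Suc k) x)"
  using \<open>k \<le> n\<close>
proof (induction k rule: inc_induct)
  case base
  show ?case using f by (simp add: f_hom_iter_last)
next
  case (step k)
  have "f_hom_iter p n f (Suc k) x = cell_problem p k (f_hom_iter p n f (Suc (Suc k)) x)"
    using step.hyps by (intro ext f_hom_iter_Suc)
  then show ?case
    using regular_integrand_cell_problem[OF step.IH \<open>p > 0\<close> ne] by simp
qed

text \<open>It interpolates between the two problems: \<open>k = 0\<close> gives the argument z of
  the iterated integrand, \<open>k = n\<close> the argument of \<open>f\<close> in
  \<open>f_hom\<close>.\<close>

definition partial_gradient_sum ::
  "real^'d^'m \<Rightarrow> (nat \<Rightarrow> (nat \<Rightarrow> real^'d) \<Rightarrow> real^'d^'m) \<Rightarrow> nat \<Rightarrow> (nat \<Rightarrow> real^'d) \<Rightarrow> real^'d^'m" where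
  "partial_gradient_sum z D k y = z + (\<Sum>i=1..k. D i (restrict y {1..i}))"

lemma partial_gradient_sum_0: "partial_gradient_sum z D 0 y = z"
  by (simp add: partial_gradient_sum_def)

lemma partial_gradient_sum_Suc:
  assumes "y \<in> cells (Suc k)"
  shows "partial_gradient_sum z D (Suc k) y =
    partial_gradient_sum z D k (restrict y {1..k}) + D (Suc k) y"
proof -
  have "restrict (restrict y {1..k}) {1..i} = restrict y {1..i}" if "i \<in> {1..k}" for i
    using that by (auto simp: restrict_def fun_eq_iff)
  then have "(\<Sum>i=1..k. D i (restrict (restrict y {1..k}) {1..i})) = (\<Sum>i=1..k. D i (restrict y {1..i}))"
    by (intro sum.cong) simp_all
  then show ?thesis
    unfolding partial_gradient_sum_def using restrict_cells[OF assms] by (simp add: add.assoc)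
qed

lemma measurable_partial_gradient_sum:
  assumes "\<And>i. i \<in> {1..k} \<Longrightarrow> D i \<in> borel_measurable (cells_measure i)"
  shows "partial_gradient_sum z D k \<in> borel_measurable (cells_measure k)"
  unfolding partial_gradient_sum_def
proof (intro borel_measurable_add borel_measurable_const borel_measurable_sum)
  fix i assume i: "i \<in> {1..k}"
  then show "(\<lambda>y. D i (restrict y {1..i})) \<in> borel_measurable (cells_measure k)"
    by (intro measurable_compose[OF measurable_restrict_cells assms]) auto
qed

lemma cells_0: "cells 0 = {\<lambda>_. undefined}"
  by (simp add: cells_def)

lemma nn_integral_cells_measure_0:
  fixes g :: "(nat \<Rightarrow> real^'d) \<Rightarrow> ennreal"
  shows "(\<integral>\<^sup>+ y. g y \<partial>cells_measure 0) = g (\<lambda>_. undefined)"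
proof -
  have "(\<integral>\<^sup>+ y. g y \<partial>cells_measure 0) =
      (\<integral>\<^sup>+ y. g (\<lambda>_. undefined) \<partial>(cells_measure 0 :: (nat \<Rightarrow> real^'d) measure))"
    by (intro nn_integral_cong) (simp add: cells_0)
  then show ?thesis by simp
qed

text \<open>Without correctors both infima run over empty sets. With n at least 1 a member of
  \<open>Phi p n\<close> would have a first component, whose value at the empty tuple is a
  corrector.\<close>

lemma Phi_empty:
  assumes "n \<ge> 1" and "(W1p_per p :: (real^'d \<Rightarrow> real^'m) set) = {}"
  shows "(Phi p n :: (nat \<Rightarrow> (nat \<Rightarrow> real^'d) \<Rightarrow> real^'d \<Rightarrow> real^'m) set) = {}"
proof (rule equals0I)
  fix \<phi> :: "nat \<Rightarrow> (nat \<Rightarrow> real^'d) \<Rightarrow> real^'d \<Rightarrow> real^'m" assume "\<phi> \<in> Phi p n"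
  then have "\<phi> 1 \<in> Bochner_Lp_W1p p (1 - 1)"
    unfolding Phi_def by (rule PiE_mem) (use \<open>n \<ge> 1\<close> in simp)
  then have "\<phi> 1 (\<lambda>_. undefined) \<in> W1p_per p"
    by (simp add: Bochner_Lp_W1p_def cells_0)
  with assms(2) show False by simp
qed

text \<open>Each step trades the outermost remaining infimum, taken at the accumulated gradient, for
  the given corrector; at \<open>k = n\<close> no infimum is left.\<close>

lemma f_hom_iter_le_integral:
  fixes f :: "real^'d \<Rightarrow> (nat \<Rightarrow> real^'d) \<Rightarrow> real^'d^'m \<Rightarrow> real"
  assumes "p > 0" and ne: "(W1p_per p :: (real^'d \<Rightarrow> real^'m) set) \<noteq> {}"
    and f: "regular_integrand p n (\<lambda>y z. ennreal (f x y z))" and "k \<le> n"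
    and \<phi>: "\<And>i. i \<in> {1..n} \<Longrightarrow> \<phi> i \<in> Bochner_Lp_W1p p (i - 1)"
    and D: "\<And>i. i \<in> {1..n} \<Longrightarrow> is_gradient_in i (\<phi> i) (D i)"
  shows "f_hom_iter p n f 1 x (\<lambda>_. undefined) z \<le>
    (\<integral>\<^sup>+ y. f_hom_iter p n f (Suc k) x y (partial_gradient_sum z D k y) \<partial>cells_measure k)"
  using \<open>k \<le> n\<close>
proof (induction k)
  case 0
  \<comment> \<open>Both sides agree: the space of empty tuples is a single point of mass 1.\<close>
  show ?case by (simp add: nn_integral_cells_measure_0 partial_gradient_sum_0 flip: One_nat_def)
next
  case (Suc k)
  let ?w = "partial_gradient_sum z D k"
  have mD: "D i \<in> borel_measurable (cells_measure i)" if "i \<in> {1..k}" for i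
    using D[of i] that Suc.prems by (simp add: is_gradient_in_def)
  have "f_hom_iter p n f 1 x (\<lambda>_. undefined) z \<le>
      (\<integral>\<^sup>+ y. cell_problem p k (f_hom_iter p n f (Suc (Suc k)) x) y (?w y) \<partial>cells_measure k)"
    using Suc.IH Suc.prems by (simp add: f_hom_iter_Suc)
  also have "\<dots> \<le> (\<integral>\<^sup>+ y. f_hom_iter p n f (Suc (Suc k)) x y (?w (restrict y {1..k}) + D (Suc k) y)
      \<partial>cells_measure (Suc k))"
  proof (rule nn_integral_cell_problem_le)
    show "regular_integrand p (Suc k) (f_hom_iter p n f (Suc (Suc k)) x)"
      by (rule regular_integrand_f_hom_iter[where f = f and x = x, OF \<open>p > 0\<close> ne f Suc.prems])
    show "?w \<in> borel_measurable (cells_measure k)"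
      by (rule measurable_partial_gradient_sum[OF mD])
    show "\<phi> (Suc k) \<in> Bochner_Lp_W1p p k" "is_gradient_in (Suc k) (\<phi> (Suc k)) (D (Suc k))"
      using \<phi>[of "Suc k"] D[of "Suc k"] Suc.prems by simp_all
  qed fact
  also have "\<dots> = (\<integral>\<^sup>+ y. f_hom_iter p n f (Suc (Suc k)) x y (partial_gradient_sum z D (Suc k) y)
      \<partial>cells_measure (Suc k))"
    by (intro nn_integral_cong) (simp add: partial_gradient_sum_Suc)
  finally show ?case .
qed

text \<open>Correctors are chosen from the first variable to the last, since each cell problem is
  posed at z plus the gradients already chosen. Every choice loses
  \<open>\<epsilon>\<close>.\<close>

lemma ex_integral_le_f_hom_iter:
  fixes f :: "real^'d \<Rightarrow> (nat \<Rightarrow> real^'d) \<Rightarrow> real^'d^'m \<Rightarrow> real"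
  assumes "p > 0" and ne: "(W1p_per p :: (real^'d \<Rightarrow> real^'m) set) \<noteq> {}"
    and f: "regular_integrand p n (\<lambda>y z. ennreal (f x y z))" and "k \<le> n" and \<epsilon>: "\<epsilon> > 0"
  shows "\<exists>\<phi> D. (\<forall>i\<in>{1..k}. \<phi> i \<in> Bochner_Lp_W1p p (i - 1) \<and> is_gradient_in i (\<phi> i) (D i)) \<and>
    (\<integral>\<^sup>+ y. ennreal (norm (partial_gradient_sum z D k y) powr p) \<partial>cells_measure k) < \<infinity> \<and>
    (\<integral>\<^sup>+ y. f_hom_iter p n f (Suc k) x y (partial_gradient_sum z D k y) \<partial>cells_measure k)
      \<le> f_hom_iter p n f 1 x (\<lambda>_. undefined) z + ennreal (real k * \<epsilon>)"
  using \<open>k \<le> n\<close>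
proof (induction k)
  case 0
  show ?case
    by (simp add: nn_integral_cells_measure_0 partial_gradient_sum_0 flip: One_nat_def)
next
  case (Suc k)
  from Suc.IH[OF Suc_leD[OF Suc.prems]] obtain \<phi> D
    where \<phi>D: "\<forall>i\<in>{1..k}. \<phi> i \<in> Bochner_Lp_W1p p (i - 1) \<and> is_gradient_in i (\<phi> i) (D i)"
    and fin: "(\<integral>\<^sup>+ y. ennreal (norm (partial_gradient_sum z D k y) powr p) \<partial>cells_measure k) < \<infinity>"
    and le: "(\<integral>\<^sup>+ y. f_hom_iter p n f (Suc k) x y (partial_gradient_sum z D k y) \<partial>cells_measure k)
      \<le> f_hom_iter p n f 1 x (\<lambda>_. undefined) z + ennreal (real k * \<epsilon>)"
    by (elim exE conjE) (rule that)
  let ?w = "partial_gradient_sum z D k" and ?h = "f_hom_iter p n f (Suc (Suc k)) x"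
  have reg: "regular_integrand p (Suc k) ?h"
    by (rule regular_integrand_f_hom_iter[where f = f and x = x, OF \<open>p > 0\<close> ne f Suc.prems])
  have mw: "?w \<in> borel_measurable (cells_measure k)"
    by (rule measurable_partial_gradient_sum) (use \<phi>D in \<open>simp add: is_gradient_in_def\<close>)
  obtain \<phi>' D' where \<phi>': "\<phi>' \<in> Bochner_Lp_W1p p k" and D': "is_gradient_in (Suc k) \<phi>' D'"
    and fin': "(\<integral>\<^sup>+ y. ennreal (norm (?w (restrict y {1..k}) + D' y) powr p) \<partial>cells_measure (Suc k)) < \<infinity>"
    and le': "(\<integral>\<^sup>+ y. ?h y (?w (restrict y {1..k}) + D' y) \<partial>cells_measure (Suc k))
      \<le> (\<integral>\<^sup>+ y. cell_problem p k ?h y (?w y) \<partial>cells_measure k) + ennreal \<epsilon>"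
    by (rule ex_almost_optimal_corrector[OF reg \<open>p > 0\<close> ne mw fin \<epsilon>]) (rule that)
  let ?\<phi> = "\<phi>(Suc k := \<phi>')" and ?D = "D(Suc k := D')"
  have "partial_gradient_sum z ?D k = ?w"
    unfolding partial_gradient_sum_def by (intro ext arg_cong2[of _ _ _ _ "(+)"] sum.cong) auto
  then have sum: "partial_gradient_sum z ?D (Suc k) y = ?w (restrict y {1..k}) + D' y"
    if "y \<in> cells (Suc k)" for y
    using partial_gradient_sum_Suc[OF that, of z ?D] by simp
  have 1: "(\<integral>\<^sup>+ y. ennreal (norm (partial_gradient_sum z ?D (Suc k) y) powr p) \<partial>cells_measure (Suc k)) < \<infinity>"
    using fin' by (subst nn_integral_cong[where v = "\<lambda>y. ennreal (norm (?w (restrict y {1..k}) + D' y) powr p)"])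
      (simp_all only: space_cells_measure sum)
  have "(\<integral>\<^sup>+ y. ?h y (partial_gradient_sum z ?D (Suc k) y) \<partial>cells_measure (Suc k))
      = (\<integral>\<^sup>+ y. ?h y (?w (restrict y {1..k}) + D' y) \<partial>cells_measure (Suc k))"
    by (intro nn_integral_cong) (simp only: space_cells_measure sum)
  also note le'
  also have "(\<integral>\<^sup>+ y. cell_problem p k ?h y (?w y) \<partial>cells_measure k)
      \<le> f_hom_iter p n f 1 x (\<lambda>_. undefined) z + ennreal (real k * \<epsilon>)"
    using le Suc.prems by (simp add: f_hom_iter_Suc)
  also have "f_hom_iter p n f 1 x (\<lambda>_. undefined) z + ennreal (real k * \<epsilon>) + ennreal \<epsilon>
      = f_hom_iter p n f 1 x (\<lambda>_. undefined) z + ennreal (real (Suc k) * \<epsilon>)"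
    using \<epsilon> by (simp add: add.assoc algebra_simps flip: ennreal_plus)
  finally have 2: "(\<integral>\<^sup>+ y. ?h y (partial_gradient_sum z ?D (Suc k) y) \<partial>cells_measure (Suc k))
      \<le> f_hom_iter p n f 1 x (\<lambda>_. undefined) z + ennreal (real (Suc k) * \<epsilon>)"
    by (simp add: add_right_mono)
  have 3: "\<forall>i\<in>{1..Suc k}. ?\<phi> i \<in> Bochner_Lp_W1p p (i - 1) \<and> is_gradient_in i (?\<phi> i) (?D i)"
    using \<phi>D \<phi>' D' by (simp add: atLeast1_Suc)
  from 1 2 3 show ?case by blast
qed

text \<open>The restriction to measurable sections selects the \<open>x\<close> at which the
  integrals are meaningful; by \<open>AE_measurable_section\<close> these are almost all points of
  the domain.\<close>

theorem mainTheorem3: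
  fixes \<Omega> :: "(real^'d) set"
    and n :: nat
    and p :: real
    and f :: "real^'d \<Rightarrow> (nat \<Rightarrow> real^'d) \<Rightarrow> real^'d^'m \<Rightarrow> real"
    and c1 c2 :: real
  assumes "open \<Omega>" and "bounded \<Omega>"
    and "n \<ge> 1" and "p > 1"
    and nonneg: "\<forall>x\<in>\<Omega>. \<forall>y\<in>cells n. \<forall>z. 0 \<le> f x y z"
    and convex: "\<forall>x\<in>\<Omega>. \<forall>y\<in>cells n. convex_on UNIV (f x y)"
    and "c1 > 0" and "c2 > 0"
    and growth: "\<forall>x\<in>\<Omega>. \<forall>y\<in>cells n. \<forall>z.
      c1 * norm z powr p \<le> f x y z \<and> f x y z \<le> c2 * (1 + norm z powr p)"
    and admissible: "admissible \<Omega> n f"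
  shows "\<forall>x\<in>\<Omega>. measurable_section n f x \<longrightarrow>
    (\<forall>z. f_hom p n f x z = f_hom_iter p n f 1 x (\<lambda>_. undefined) z)"
proof (intro ballI impI allI)
  fix x and z :: "real^'d^'m" assume x: "x \<in> \<Omega>" and meas: "measurable_section n f x"
  have "p > 0" using \<open>p > 1\<close> by simp
  let ?J = "\<lambda>D. \<integral>\<^sup>+ y. ennreal (f x y (z + (\<Sum>k=1..n. D k (restrict y {1..k})))) \<partial>cells_measure n"
  let ?A = "{?J D | \<phi> D. (\<phi> :: nat \<Rightarrow> (nat \<Rightarrow> real^'d) \<Rightarrow> real^'d \<Rightarrow> real^'m) \<in> Phi p n \<and>
    (\<forall>k\<in>{1..n}. is_gradient_in k (\<phi> k) (D k))}"
  have hom: "f_hom p n f x z = Inf ?A"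
    by (simp only: f_hom_def)
  show "f_hom p n f x z = f_hom_iter p n f 1 x (\<lambda>_. undefined) z"
  \<comment> \<open>The case distinction takes the place of exhibiting a corrector, for which the
    version selected by \<open>weak_gradient\<close> would have to be identified.\<close>
  proof (cases "(W1p_per p :: (real^'d \<Rightarrow> real^'m) set) = {}")
    case True
    have "f_hom_iter p n f 1 x (\<lambda>_. undefined) z = top"
      using \<open>n \<ge> 1\<close> True by (subst f_hom_iter.simps) simp
    moreover have "f_hom p n f x z = top"
      unfolding hom Phi_empty[OF \<open>n \<ge> 1\<close> True] by simp
    ultimately show ?thesis by simp
  next
    case ne: False
    have reg: "regular_integrand p n (\<lambda>y z. ennreal (f x y z))"
      using \<open>p > 0\<close> \<open>c1 > 0\<close> \<open>c2 > 0\<close>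
      by (rule regular_integrand_of_convex)
        (use meas convex growth x in \<open>auto simp: measurable_section_def\<close>)
    show ?thesis
    proof (rule antisym)
      show "f_hom_iter p n f 1 x (\<lambda>_. undefined) z \<le> f_hom p n f x z"
        unfolding hom
      proof (rule Inf_greatest)
        fix a assume "a \<in> ?A"
        then obtain \<phi> :: "nat \<Rightarrow> (nat \<Rightarrow> real^'d) \<Rightarrow> real^'d \<Rightarrow> real^'m" and D
          where a: "a = ?J D" and \<phi>: "\<phi> \<in> Phi p n"
          and D: "\<And>k. k \<in> {1..n} \<Longrightarrow> is_gradient_in k (\<phi> k) (D k)"
          by blast
        have "\<phi> i \<in> Bochner_Lp_W1p p (i - 1)" if "i \<in> {1..n}" for i
          using \<phi> that unfolding Phi_def by (rule PiE_mem)
        from f_hom_iter_le_integral[where f = f and x = x, OF \<open>p > 0\<close> ne reg order_refl this D]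
        show "f_hom_iter p n f 1 x (\<lambda>_. undefined) z \<le> a"
          by (simp only: a f_hom_iter_last partial_gradient_sum_def)
      qed
      show "f_hom p n f x z \<le> f_hom_iter p n f 1 x (\<lambda>_. undefined) z"
      proof (rule ennreal_le_epsilon)
        fix e :: real assume "e > 0"
        \<comment> \<open>The error e is shared equally among the n successive choices.\<close>
        then have "e / n > 0" using \<open>n \<ge> 1\<close> by simp
        from ex_integral_le_f_hom_iter[where f = f and x = x and z = z, OF \<open>p > 0\<close> ne reg order_refl this]
        obtain \<phi> :: "nat \<Rightarrow> (nat \<Rightarrow> real^'d) \<Rightarrow> real^'d \<Rightarrow> real^'m" and D where
          \<phi>: "\<forall>i\<in>{1..n}. \<phi> i \<in> Bochner_Lp_W1p p (i - 1) \<and> is_gradient_in i (\<phi> i) (D i)"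
          and le: "(\<integral>\<^sup>+ y. f_hom_iter p n f (Suc n) x y (partial_gradient_sum z D n y) \<partial>cells_measure n)
            \<le> f_hom_iter p n f 1 x (\<lambda>_. undefined) z + ennreal (real n * (e / n))"
          by (elim exE conjE) (rule that)
        have "restrict \<phi> {1..n} \<in> Phi p n"
          using \<phi> by (simp add: Phi_def)
        moreover have "\<forall>k\<in>{1..n}. is_gradient_in k (restrict \<phi> {1..n} k) (D k)"
          using \<phi> by simp
        ultimately have "?J D \<in> ?A"
          by blast
        then have "f_hom p n f x z \<le> ?J D"
          unfolding hom by (rule Inf_lower)
        also have "\<dots> \<le> f_hom_iter p n f 1 x (\<lambda>_. undefined) z + ennreal e"
          using le \<open>n \<ge> 1\<close> by (simp add: f_hom_iter_last partial_gradient_sum_def)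
        finally show "f_hom p n f x z \<le> f_hom_iter p n f 1 x (\<lambda>_. undefined) z + ennreal e" .
      qed
    qed
  qed
qed

end
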